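(* Let $\Phi=(\phi_1,\phi_2)$, where $\phi_1,\phi_2$ are rational inner functions on $\mathbb{D}^2$ with a common singularity $\omega=(\omega_1,\omega_2)\in\mathbb{T}^2$, and let $\alpha_1,\alpha_2\in\mathbb{T}$ be generic values of $\phi_1,\phi_2$ respectively at $\omega$ which are admissible (as defined in the context). Assume that there exist two analytic curves $(\zeta,g^{\alpha_1,\phi_1}_{j_1}(\zeta))$ in $\mathcal{C}_{\alpha_1}(\phi_1)$ and $(\zeta,g^{\alpha_2,\phi_2}_{j_2}(\zeta))$ in $\mathcal{C}_{\alpha_2}(\phi_2)$, with respective contact orders $K_{\phi_1},K_{\phi_2}\ge2$, which intersect tangentially at $\omega$ with order $M>2K+1$, where $K:=\max\{K_{\phi_1},K_{\phi_2}\}$, i.e. $$|g^{\alpha_1,\phi_1}_{j_1}(\zeta)-g^{\alpha_2,\phi_2}_{j_2}(\zeta)|\approx|\zeta-\omega_1|^M$$ for $\zeta\in\mathbb{T}$ near $\omega_1$. Then the composition operator $C_\Phi:A^2_\beta(\mathbb{D}^2)\to A^2_\beta(\mathbb{D}^2)$ is not bounded whenever $M>K(2\beta+4)+1$, or equivalently, for all $-1<\beta<\frac{M-1}{2K}-2$.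
   Context: $\mathbb{D}^2$ is the unit bidisc in $\mathbb{C}^2$, $\mathbb{T}^2$ the bitorus. For $\beta>-1$, $A^2_\beta(\mathbb{D}^2)$ is the space of holomorphic $f$ on $\mathbb{D}^2$ with $\int_{\mathbb{D}^2}|f|^2(1-|z_1|^2)^\beta(1-|z_2|^2)^\beta dV<\infty$, where $dV=dA\times dA$ and $dA=\frac1\pi dx\,dy$. $C_\Phi f=f\circ\Phi$. $A\approx B$ means $C_1B\le A\le C_2B$ with positive constants $C_1,C_2$. Rational inner functions (RIFs) are taken of the form $\phi=\widetilde p/p$ with $p\in\mathbb{C}[z_1,z_2]$ of bidegree $(n,m)$ stable (no zeros in $\mathbb{D}^2$) and $\widetilde p(z_1,z_2)=z_1^nz_2^m\overline{p(1/\overline{z_1},1/\overline{z_2})}$. A singularity is a point of $\mathbb{T}^2$ where $p$ vanishes (with $p,\widetilde p$ without common factors). $\phi$ has a non-tangential limit $\phi^*(\zeta)\in\mathbb{T}$ at every $\zeta\in\mathbb{T}^2$, and for $\alpha\in\mathbb{T}$ the level set is $\mathcal{C}_\alpha(\phi)=\mathrm{clos}\{\zeta\in\mathbb{T}^2:\phi^*(\zeta)=\alpha\}$. A value $\alpha\in\mathbb{T}$ is exceptional if $\mathcal{C}_\alpha(\phi)$ contains a line $\{\zeta_1=\tau\}$ or $\{\zeta_2=\tau\}$ with $\tau\in\mathbb{T}$; otherwise it is generic. Parametrization of level sets: for each $\alpha\in\mathbb{T}$ and any choice of $\tau_0\in\mathbb{T}$ there are finitely many functions $g_1^{\alpha,\phi},\dots,g_N^{\alpha,\phi}:\mathbb{T}\to\mathbb{T}$,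 analytic on $\mathbb{T}\setminus\{\tau_0\}$, such that $\mathcal{C}_\alpha(\phi)$ is the union of the graphs $\{(\zeta,g_j^{\alpha,\phi}(\zeta)):\zeta\in\mathbb{T}\}$, possibly together with finitely many vertical lines. Contact orders and admissible values: for $\zeta_2\in\mathbb{T}$, let $a_1(\zeta_2),\dots,a_n(\zeta_2)$ be the zeros of the finite Blaschke product $\phi(\cdot,\zeta_2)$. If $\phi$ has a singularity with $z_2$-coordinate $\tau_2$, there is $K>0$ with $\min_j(1-|a_j(\zeta_2)|)\approx|\tau_2-\zeta_2|^K$ for $\zeta_2\in\mathbb{T}$ near $\tau_2$; this is the local contact order, and the contact order of $\phi$ is the maximum of these over its singularities (it is an even integer $\ge2$). Individual branches of level sets through the singularity have their own contact orders, and it is a known theorem (Anderson, Bergqvist, Bickel, Cima, Sola) that for all but finitely many $\alpha\in\mathbb{T}$ the branch $g_j^{\alpha,\phi}$ through a singularity $\omega$ of contact order $K_\phi$ satisfies $$\left|\frac{\partial\phi}{\partial z_2}(\zeta,g_j^{\alpha,\phi}(\zeta))\right|^{-1}\approx|\zeta-\omega_1|^{K_\phi}\quad\text{for }\zeta\in\mathbb{T}\text{ near }\omega_1.$$ A generic value $\alpha$ is called admissible if it is not among these finitely many exceptions, i.e. this estimate holds. *)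

theory Defs
  imports "HOL-Complex_Analysis.Complex_Analysis" "HOL-Library.Landau_Symbols"
    "HOL-Computational_Algebra.Polynomial"
begin

abbreviation torus :: "complex set" where
  "torus \<equiv> sphere 0 1"

definition bidisc :: "(complex \<times> complex) set" where
  "bidisc = ball 0 1 \<times> ball 0 1"

definition bitorus :: "(complex \<times> complex) set" where
  "bitorus = torus \<times> torus"


section \<open>Rational inner functions\<close>

text \<open>
  A polynomial in $z_1, z_2$ is an element of \<^typ>\<open>complex poly poly\<close>: the outer variable is
  $z_2$, the inner one $z_1$, so \<open>coeff (coeff p j) i\<close> is the coefficient of $z_1^i z_2^j$.
\<close>

definition poly2 :: "complex poly poly \<Rightarrow> complex \<times> complex \<Rightarrow> complex" where
  "poly2 p z = poly (poly p [:snd z:]) (fst z)"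

definition degree1 :: "complex poly poly \<Rightarrow> nat" where
  "degree1 p = (MAX j\<in>{..degree p}. degree (coeff p j))"

definition degree2 :: "complex poly poly \<Rightarrow> nat" where
  "degree2 p = degree p"

text \<open>
  The reflection is given by its coefficients, as a polynomial is needed to speak of common
  factors; \<open>poly2_reflect2\<close> below is the usual formula for it.
\<close>

definition reflect2 :: "complex poly poly \<Rightarrow> complex poly poly" where
  "reflect2 p = (\<Sum>j\<le>degree2 p. \<Sum>i\<le>degree1 p.
     monom (monom (cnj (coeff (coeff p (degree2 p - j)) (degree1 p - i))) i) j)"

lemma poly2_sum: "poly2 (\<Sum>x\<in>A. f x) z = (\<Sum>x\<in>A. poly2 (f x) z)"
  by (simp add: poly2_def poly_sum)

lemma poly2_monom: "poly2 (monom (monom c i) j) z = c * fst z ^ i * snd z ^ j"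
  by (simp add: poly2_def poly_monom poly_power)

lemma poly2_altdef:
  "poly2 p z = (\<Sum>j\<le>degree2 p. \<Sum>i\<le>degree1 p. coeff (coeff p j) i * fst z ^ i * snd z ^ j)"
proof -
  have deg: "degree (coeff p j) \<le> degree1 p" if "j \<le> degree p" for j
    unfolding degree1_def using that by (intro Max_ge) auto
  have "poly2 p z = (\<Sum>j\<le>degree p. poly (coeff p j) (fst z) * snd z ^ j)"
    by (simp add: poly2_def poly_altdef[of p] poly_sum poly_power)
  also have "\<dots> = (\<Sum>j\<le>degree p. (\<Sum>i\<le>degree1 p. coeff (coeff p j) i * fst z ^ i) * snd z ^ j)"
  proof (intro sum.cong refl)
    fix j assume "j \<in> {..degree p}"
    then have "(\<Sum>i\<le>degree (coeff p j). coeff (coeff p j) i * fst z ^ i) =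
        (\<Sum>i\<le>degree1 p. coeff (coeff p j) i * fst z ^ i)"
      by (intro sum.mono_neutral_left) (use deg[of j] in \<open>auto simp: coeff_eq_0\<close>)
    then show "poly (coeff p j) (fst z) * snd z ^ j =
        (\<Sum>i\<le>degree1 p. coeff (coeff p j) i * fst z ^ i) * snd z ^ j"
      by (simp add: poly_altdef[of "coeff p j"])
  qed
  finally show ?thesis
    by (simp add: degree2_def sum_distrib_right)
qed

lemma poly2_reflect2:
  assumes "z1 \<noteq> 0" "z2 \<noteq> 0"
  shows "poly2 (reflect2 p) (z1, z2) =
    z1 ^ degree1 p * z2 ^ degree2 p * cnj (poly2 p (1 / cnj z1, 1 / cnj z2))"
proof -
  define n m where "n = degree1 p" and "m = degree2 p"
  define c where "c = (\<lambda>j i. cnj (coeff (coeff p j) i))"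
  have "poly2 (reflect2 p) (z1, z2) = (\<Sum>j\<le>m. \<Sum>i\<le>n. c (m - j) (n - i) * z1 ^ i * z2 ^ j)"
    by (simp add: reflect2_def poly2_sum poly2_monom n_def m_def c_def)
  also have "\<dots> = (\<Sum>j\<le>m. \<Sum>i\<le>n. c j (n - i) * z1 ^ i * z2 ^ (m - j))"
    by (rule sum.reindex_bij_witness[where i = "\<lambda>j. m - j" and j = "\<lambda>j. m - j"]) auto
  also have "\<dots> = (\<Sum>j\<le>m. \<Sum>i\<le>n. c j i * z1 ^ (n - i) * z2 ^ (m - j))"
    by (intro sum.cong[OF refl]
        sum.reindex_bij_witness[where i = "\<lambda>i. n - i" and j = "\<lambda>i. n - i"]) auto
  also have "\<dots> = (\<Sum>j\<le>m. \<Sum>i\<le>n. z1 ^ n * z2 ^ m * (c j i * (1 / z1) ^ i * (1 / z2) ^ j))"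
    using assms by (intro sum.cong refl) (auto simp: power_diff power_one_over field_simps)
  also have "\<dots> = z1 ^ n * z2 ^ m * cnj (poly2 p (1 / cnj z1, 1 / cnj z2))"
    by (simp add: poly2_altdef sum_distrib_left n_def m_def c_def)
  finally show ?thesis
    by (simp add: n_def m_def)
qed

definition stable :: "complex poly poly \<Rightarrow> bool" where
  "stable p \<longleftrightarrow> (\<forall>z\<in>bidisc. poly2 p z \<noteq> 0)"

text \<open>The polynomials that are denominators of rational inner functions in lowest terms.\<close>

definition rif_denominator :: "complex poly poly \<Rightarrow> bool" where
  "rif_denominator p \<longleftrightarrow> stable p \<and> coprime p (reflect2 p)"

definition rif :: "complex poly poly \<Rightarrow> complex \<times> complex \<Rightarrow> complex" where
  "rif p z = poly2 (reflect2 p) z / poly2 p z"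

definition singularities :: "complex poly poly \<Rightarrow> (complex \<times> complex) set" where
  "singularities p = {\<omega> \<in> bitorus. poly2 p \<omega> = 0}"


section \<open>Boundary values and level sets\<close>

definition approach_region :: "real \<Rightarrow> complex \<times> complex \<Rightarrow> (complex \<times> complex) set" where
  "approach_region c \<zeta> = {z \<in> bidisc.
     max (dist (fst z) (fst \<zeta>)) (dist (snd z) (snd \<zeta>)) \<le> c * (1 - max (norm (fst z)) (norm (snd z)))}"

definition has_nontangential_limit ::
    "(complex \<times> complex \<Rightarrow> complex) \<Rightarrow> complex \<times> complex \<Rightarrow> complex \<Rightarrow> bool" where
  "has_nontangential_limit \<phi> \<zeta> l \<longleftrightarrow> (\<forall>c. (\<phi> \<longlongrightarrow> l) (at \<zeta> within approach_region c \<zeta>))"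

definition level_set :: "(complex \<times> complex \<Rightarrow> complex) \<Rightarrow> complex \<Rightarrow> (complex \<times> complex) set" where
  "level_set \<phi> \<alpha> = closure {\<zeta> \<in> bitorus. has_nontangential_limit \<phi> \<zeta> \<alpha>}"

definition exceptional_value :: "(complex \<times> complex \<Rightarrow> complex) \<Rightarrow> complex \<Rightarrow> bool" where
  "exceptional_value \<phi> \<alpha> \<longleftrightarrow> \<alpha> \<in> torus \<and>
     (\<exists>\<tau>\<in>torus. {\<tau>} \<times> torus \<subseteq> level_set \<phi> \<alpha> \<or> torus \<times> {\<tau>} \<subseteq> level_set \<phi> \<alpha>)"

definition generic_value :: "(complex \<times> complex \<Rightarrow> complex) \<Rightarrow> complex \<Rightarrow> bool" where
  "generic_value \<phi> \<alpha> \<longleftrightarrow> \<alpha> \<in> torus \<and> \<not> exceptional_value \<phi> \<alpha>"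

text \<open>
  The functions \<open>g j\<close> live on the circle, and only their values there matter. Analyticity on
  the punctured circle means that there is a holomorphic extension to a neighbourhood of it.
\<close>

definition level_parametrization ::
    "(complex \<times> complex \<Rightarrow> complex) \<Rightarrow> complex \<Rightarrow> complex \<Rightarrow> nat \<Rightarrow> (nat \<Rightarrow> complex \<Rightarrow> complex) \<Rightarrow> bool" where
  "level_parametrization \<phi> \<alpha> \<tau>0 N g \<longleftrightarrow>
     (\<forall>j<N. g j ` torus \<subseteq> torus \<and>
        (\<exists>h. h analytic_on (torus - {\<tau>0}) \<and> (\<forall>\<zeta>\<in>torus - {\<tau>0}. h \<zeta> = g j \<zeta>))) \<and>
     (\<exists>V. finite V \<and> V \<subseteq> torus \<and>
        level_set \<phi> \<alpha> = (\<Union>j<N. (\<lambda>\<zeta>. (\<zeta>, g j \<zeta>)) ` torus) \<union> V \<times> torus)"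


section \<open>Contact orders and admissible values\<close>

text \<open>
  \<open>zero_contact_order \<phi> \<omega> K\<close>: some selection $a(\zeta_2)$ among the zeros $a_j(\zeta_2)$ of
  $\phi(\cdot,\zeta_2)$ tends to $\omega_1$ and satisfies
  $1 - |a(\zeta_2)| \approx |\zeta_2 - \omega_2|^K$. A singularity may carry several such orders,
  one for each of its branches; selecting a zero with $1 - |a_j(\zeta_2)|$ minimal yields the
  largest of them, which is the local contact order. The filter
  \<open>at _ within torus\<close> excludes the base point, where \<open>\<phi>\<close> need not be defined.
\<close>

definition zero_contact_order ::
    "(complex \<times> complex \<Rightarrow> complex) \<Rightarrow> complex \<times> complex \<Rightarrow> real \<Rightarrow> bool" where
  "zero_contact_order \<phi> \<omega> K \<longleftrightarrow> (\<exists>a.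
     (\<forall>\<^sub>F \<zeta>2 in at (snd \<omega>) within torus. a \<zeta>2 \<in> ball 0 1 \<and> \<phi> (a \<zeta>2, \<zeta>2) = 0) \<and>
     (a \<longlongrightarrow> fst \<omega>) (at (snd \<omega>) within torus) \<and>
     (\<lambda>\<zeta>2. 1 - norm (a \<zeta>2)) \<in> \<Theta>[at (snd \<omega>) within torus](\<lambda>\<zeta>2. dist \<zeta>2 (snd \<omega>) powr K))"

text \<open>
  The contact order of an individual branch \<open>g\<close> of a level set through \<open>\<omega>\<close>: the contact order
  $K$ of \<open>\<phi>\<close> at \<open>\<omega>\<close> that governs the branch through
  $|\partial\phi/\partial z_2(\zeta,g(\zeta))|^{-1} \approx |\zeta-\omega_1|^K$.
\<close>

definition branch_contact_order ::
    "(complex \<times> complex \<Rightarrow> complex) \<Rightarrow> complex \<times> complex \<Rightarrow> (complex \<Rightarrow> complex) \<Rightarrow> real \<Rightarrow> bool" where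
  "branch_contact_order \<phi> \<omega> g K \<longleftrightarrow> zero_contact_order \<phi> \<omega> K \<and>
     (\<lambda>\<zeta>. inverse (norm (deriv (\<lambda>w. \<phi> (\<zeta>, w)) (g \<zeta>))))
       \<in> \<Theta>[at (fst \<omega>) within torus](\<lambda>\<zeta>. dist \<zeta> (fst \<omega>) powr K)"

text \<open>
  The puncture \<open>\<tau>0\<close> of a parametrization may be chosen freely; it is kept away from $\omega_1$,
  so that the branches are analytic at $\omega_1$.
\<close>

definition admissible_value ::
    "(complex \<times> complex \<Rightarrow> complex) \<Rightarrow> complex \<times> complex \<Rightarrow> complex \<Rightarrow> bool" where
  "admissible_value \<phi> \<omega> \<alpha> \<longleftrightarrow> generic_value \<phi> \<alpha> \<and>
     (\<forall>\<tau>0 N g. \<tau>0 \<in> torus - {fst \<omega>} \<longrightarrow> level_parametrization \<phi> \<alpha> \<tau>0 N g \<longrightarrow>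
        (\<forall>j<N. g j (fst \<omega>) = snd \<omega> \<longrightarrow> (\<exists>K. branch_contact_order \<phi> \<omega> (g j) K)))"


section \<open>Weighted Bergman spaces and composition operators\<close>

definition holomorphic2_on :: "(complex \<times> complex \<Rightarrow> complex) \<Rightarrow> (complex \<times> complex) set \<Rightarrow> bool" where
  "holomorphic2_on f S \<longleftrightarrow>
     (\<forall>z\<in>S. \<exists>a b. (f has_derivative (\<lambda>h. a * fst h + b * snd h)) (at z within S))"

text \<open>The density with respect to Lebesgue measure; $dA$ is normalised to be $dx\,dy/\pi$.\<close>

definition bergman_weight :: "real \<Rightarrow> complex \<times> complex \<Rightarrow> real" where
  "bergman_weight \<beta> z =
     (1 - (norm (fst z))\<^sup>2) powr \<beta> * (1 - (norm (snd z))\<^sup>2) powr \<beta> / pi\<^sup>2"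

definition bergman_space :: "real \<Rightarrow> (complex \<times> complex \<Rightarrow> complex) set" where
  "bergman_space \<beta> = {f. holomorphic2_on f bidisc \<and>
     set_integrable lborel bidisc (\<lambda>z. (norm (f z))\<^sup>2 * bergman_weight \<beta> z)}"

definition bergman_norm :: "real \<Rightarrow> (complex \<times> complex \<Rightarrow> complex) \<Rightarrow> real" where
  "bergman_norm \<beta> f = sqrt (set_lebesgue_integral lborel bidisc (\<lambda>z. (norm (f z))\<^sup>2 * bergman_weight \<beta> z))"

definition bounded_composition_operator ::
    "real \<Rightarrow> (complex \<times> complex \<Rightarrow> complex \<times> complex) \<Rightarrow> bool" where
  "bounded_composition_operator \<beta> \<Phi> \<longleftrightarrow>
     (\<forall>f\<in>bergman_space \<beta>. f \<circ> \<Phi> \<in> bergman_space \<beta>) \<and>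
     (\<exists>C. \<forall>f\<in>bergman_space \<beta>. bergman_norm \<beta> (f \<circ> \<Phi>) \<le> C * bergman_norm \<beta> f)"

end

theory Submission
  imports Defs
begin

text \<open>
  Let \<open>\<zeta>\<close> be a point of the circle at distance about \<open>T\<close> from \<open>\<omega>\<^sub>1\<close>. On the branch of \<open>\<phi>\<^sub>j\<close> over \<open>\<zeta>\<close> the
  gradient of \<open>\<phi>\<^sub>j\<close> is \<open>O(T\<^bsup>-K\<^esup>)\<close>. By Julia's lemma and Harnack's inequality \<open>\<phi>\<^sub>j\<close> therefore differs
  from \<open>\<alpha>\<^sub>j\<close> by \<open>O(r T\<^bsup>-K\<^esup>)\<close> on a polydisc of size \<open>r\<close> at distance \<open>r\<close> from the boundary point. For
  \<open>r\<close> of order \<open>T\<^sup>M\<close> these polydiscs overlap for the two branches, so \<open>\<Phi>\<close> maps their union over \<open>\<zeta>\<close>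
  into the \<open>\<delta>\<close>-neighbourhood of \<open>(\<alpha>\<^sub>1, \<alpha>\<^sub>2)\<close> with \<open>\<delta>\<close> of order \<open>T\<^bsup>M - K\<^esup>\<close>. The union has weighted
  volume at least of order \<open>T r\<^bsup>2 \<beta> + 3\<^esup>\<close>. Testing boundedness on powers of reproducing kernels bounds
  it by a multiple of \<open>\<delta>\<^bsup>2 \<beta> + 4\<^esup>\<close>, which as \<open>T\<close> tends to \<open>0\<close> forces
  \<open>1 + M (2 \<beta> + 3) \<ge> (M - K) (2 \<beta> + 4)\<close>, that is, \<open>M \<le> K (2 \<beta> + 4) + 1\<close>.
\<close>

section \<open>Schwarz-Pick, Julia and Harnack estimates\<close>

text \<open>The first derivatives grow without bound along the branches as \<open>\<omega>\<close>
  is approached, and no bound on higher derivatives is available, so a Taylor expansion at the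
  boundary controls nothing at depth \<open>r\<close>. Julia's lemma asks only for the first
  derivative at one boundary point and holds for every \<open>r < 1\<close> with an absolute
  constant; this uniformity lets \<open>r\<close> and \<open>T\<close> shrink together. It controls
  a single radial point, which has no volume; Harnack's inequality spreads the estimate because
  \<open>1 - cnj \<alpha> * \<phi>\<close> has nonnegative real part.

  The exponents arise as follows. The kernel power with exponent \<open>n\<close> at
  \<open>(1 - \<delta>) (\<alpha>1, \<alpha>2)\<close> has squared modulus at least of order
  \<open>\<delta> powr (- 4 n)\<close> on the \<open>\<delta>\<close>-neighbourhood and squared norm
  at most of order \<open>\<delta> powr (2 \<beta> + 4 - 4 n)\<close>; the quotient leaves
  \<open>2 \<beta> + 4\<close>. On the other side, about \<open>T / r\<close> disjoint polydiscs
  have weighted volume of order \<open>r powr (2 \<beta> + 4)\<close> each, which is the source of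
  \<open>2 \<beta> + 3\<close>.\<close>

lemma Schwarz_Pick_strict:
  assumes f: "f holomorphic_on ball 0 1" "\<And>z. norm z < 1 \<Longrightarrow> norm (f z) < 1"
    and a: "norm a < 1" and b: "norm b < 1"
  shows "norm ((f a - f b) / (1 - cnj (f b) * f a)) \<le> norm ((a - b) / (1 - cnj b * a))"
proof -
  \<comment> \<open>Conjugation by disc automorphisms: \<open>u\<close> sends \<open>0\<close> to
    \<open>b\<close> and inverts the automorphism that defines \<open>c\<close>, while
    \<open>v\<close> sends \<open>f b\<close> to \<open>0\<close>. So
    \<open>v \<circ> (f \<circ> u)\<close> fixes \<open>0\<close>, and Schwarz's lemma at
    \<open>c\<close> is the claim.\<close>
  define u where "u = Moebius_function 0 (-b)"
  define v where "v = Moebius_function 0 (f b)"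
  define c where "c = Moebius_function 0 b a"
  have fb: "norm (f b) < 1" using f b by auto
  have c: "norm c < 1" unfolding c_def using Moebius_function_norm_lt_1[OF b a] .
  have u: "norm (u z) < 1" if "norm z < 1" for z
    unfolding u_def using Moebius_function_norm_lt_1[of "-b" z] b that by auto
  have v: "norm (v z) < 1" if "norm z < 1" for z
    unfolding v_def using Moebius_function_norm_lt_1[of "f b" z] fb that by auto
  have hu: "u holomorphic_on ball 0 1" "v holomorphic_on ball 0 1"
    unfolding u_def v_def using Moebius_function_holomorphic fb b by auto
  have "(f \<circ> u) holomorphic_on ball 0 1"
    by (rule holomorphic_on_compose_gen[OF hu(1) f(1)]) (use u in auto)
  then have "(v \<circ> (f \<circ> u)) holomorphic_on ball 0 1"
    by (rule holomorphic_on_compose_gen[OF _ hu(2)]) (use u f in auto)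
  moreover have "(v \<circ> (f \<circ> u)) 0 = 0"
    by (simp add: u_def v_def Moebius_function_of_zero Moebius_function_eq_zero)
  moreover have "norm ((v \<circ> (f \<circ> u)) z) < 1" if "norm z < 1" for z
    using u v f that by auto
  ultimately have "norm ((v \<circ> (f \<circ> u)) c) \<le> norm c"
    using Schwarz_Lemma(1)[of "v \<circ> (f \<circ> u)" c] c by blast
  moreover have "u c = a"
    unfolding u_def c_def using Moebius_function_compose[of "-b" b a] a b by auto
  ultimately show ?thesis
    by (simp add: v_def c_def Moebius_function_simple)
qed

text \<open>The usual identity behind the pseudo-hyperbolic distance; it converts the quotient form
  of the Schwarz-Pick inequality into a form without division.\<close>

lemma one_minus_norm2_mult_eq:
  fixes a b :: complex
  shows "(1 - (norm a)\<^sup>2) * (1 - (norm b)\<^sup>2) = (norm (1 - cnj b * a))\<^sup>2 - (norm (a - b))\<^sup>2"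
  unfolding cmod_power2 by (simp add: power2_eq_square algebra_simps)

text \<open>Clearing denominators keeps the inequality meaningful when \<open>f\<close> attains
  modulus \<open>1\<close>, where the quotient may be \<open>0 / 0\<close>. The strict case applies
  to \<open>t * f\<close> for \<open>t < 1\<close>, and every term is continuous in
  \<open>t\<close>, so \<open>t\<close> may tend to \<open>1\<close>.\<close>

lemma Schwarz_Pick:
  assumes f: "f holomorphic_on ball 0 1" "\<And>z. norm z < 1 \<Longrightarrow> norm (f z) \<le> 1"
    and a: "norm a < 1" and b: "norm b < 1"
  shows "(1 - (norm a)\<^sup>2) * (1 - (norm b)\<^sup>2) * (norm (1 - cnj (f b) * f a))\<^sup>2
       \<le> (1 - (norm (f a))\<^sup>2) * (1 - (norm (f b))\<^sup>2) * (norm (1 - cnj b * a))\<^sup>2"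
proof -
  have strict: "(1 - (norm a)\<^sup>2) * (1 - (norm b)\<^sup>2) * (norm (1 - cnj (g b) * g a))\<^sup>2
       \<le> (1 - (norm (g a))\<^sup>2) * (1 - (norm (g b))\<^sup>2) * (norm (1 - cnj b * a))\<^sup>2"
    if g: "g holomorphic_on ball 0 1" "\<And>z. norm z < 1 \<Longrightarrow> norm (g z) < 1" for g
  proof -
    define x y X Y where "x = (norm (a - b))\<^sup>2" and "y = (norm (1 - cnj b * a))\<^sup>2"
      and "X = (norm (g a - g b))\<^sup>2" and "Y = (norm (1 - cnj (g b) * g a))\<^sup>2"
    have nz: "cnj w * z \<noteq> 1" if "norm w < 1" "norm z < 1" for w z :: complex
      using that mult_strict_mono'[of "norm w" 1 "norm z" 1]
      by (auto simp: norm_mult dest!: arg_cong[of _ 1 norm])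
    have pos: "y > 0" "Y > 0" using nz[OF b a] nz[OF g(2)[OF b] g(2)[OF a]] by (auto simp: y_def Y_def)
    have "(norm ((g a - g b) / (1 - cnj (g b) * g a)))\<^sup>2 \<le> (norm ((a - b) / (1 - cnj b * a)))\<^sup>2"
      by (rule power_mono[OF Schwarz_Pick_strict[OF g a b]]) auto
    then have "X / Y \<le> x / y" by (simp add: norm_divide power_divide X_def Y_def x_def y_def)
    then have "X * y \<le> x * Y" using pos by (simp add: field_simps)
    then show ?thesis
      unfolding one_minus_norm2_mult_eq X_def[symmetric] Y_def[symmetric] x_def[symmetric] y_def[symmetric]
      by (simp add: algebra_simps)
  qed
  have *: "(1 - (norm a)\<^sup>2) * (1 - (norm b)\<^sup>2) * (norm (1 - cnj (of_real t * f b) * (of_real t * f a)))\<^sup>2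
       \<le> (1 - (norm (of_real t * f a))\<^sup>2) * (1 - (norm (of_real t * f b))\<^sup>2) * (norm (1 - cnj b * a))\<^sup>2"
    if "t \<in> {0<..<1}" for t :: real
  proof (rule strict)
    show "(\<lambda>z. of_real t * f z) holomorphic_on ball 0 1" by (intro holomorphic_intros f)
    show "norm (of_real t * f z) < 1" if "norm z < 1" for z
    proof -
      have "t * norm (f z) \<le> t * 1" using f(2)[OF that] \<open>t \<in> _\<close> by (intro mult_left_mono) auto
      also have "\<dots> < 1" using \<open>t \<in> _\<close> by simp
      finally show ?thesis using \<open>t \<in> _\<close> by (simp add: norm_mult)
    qed
  qed
  have ev: "\<forall>\<^sub>F t in at_left (1::real). t \<in> {0<..<1}"
    by (rule eventually_at_leftI[of 0]) auto
  have lim: "((\<lambda>t. of_real t) \<longlongrightarrow> (1::complex)) (at_left 1)"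
    using tendsto_of_real[OF tendsto_ident_at, of "1::real"] by auto
  have "(1 - (norm a)\<^sup>2) * (1 - (norm b)\<^sup>2) * (norm (1 - cnj (1 * f b) * (1 * f a)))\<^sup>2
       \<le> (1 - (norm (1 * f a))\<^sup>2) * (1 - (norm (1 * f b))\<^sup>2) * (norm (1 - cnj b * a))\<^sup>2"
    by (rule tendsto_le[OF _ _ _ eventually_mono[OF ev *]]; (intro tendsto_intros)?)
      (simp_all add: lim)
  then show ?thesis by simp
qed

text \<open>Divide the Schwarz-Pick inequality for the points \<open>1 - r\<close> and \<open>s\<close> by \<open>1 - s\<^sup>2\<close> and let
  \<open>s\<close> tend to \<open>1\<close>.\<close>

lemma Julia_radial:
  assumes f: "f holomorphic_on ball 0 1" "\<And>z. norm z < 1 \<Longrightarrow> norm (f z) \<le> 1"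
    and d: "(f has_field_derivative d) (at 1)" and \<alpha>: "norm (f 1) = 1" and r: "0 < r" "r < 1"
  shows "norm (f 1 - f (of_real (1 - r))) \<le> 4 * r * norm d"
proof -
  define a where "a = (of_real (1 - r) :: complex)"
  define h where "h = norm (f 1 - f a)"
  have na: "norm a = 1 - r" using r by (simp add: a_def del: of_real_diff)
  have h0: "h \<ge> 0" by (simp add: h_def)
  have lim: "((\<lambda>s. of_real s) \<longlongrightarrow> (1::complex)) (at_left 1)"
    using tendsto_of_real[OF tendsto_ident_at, of "1::real"] by auto
  have lim2: "filterlim (\<lambda>s. of_real s :: complex) (at 1) (at_left (1::real))"
    unfolding filterlim_at
  proof
    show "\<forall>\<^sub>F x in at_left 1. complex_of_real x \<in> UNIV \<and> complex_of_real x \<noteq> 1"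
      by (auto simp: eventually_at_filter)
  qed (rule lim)
  have fcont: "((\<lambda>s. f (of_real s)) \<longlongrightarrow> f 1) (at_left (1::real))"
    using isContD[OF DERIV_isCont[OF d]] filterlim_compose[OF _ lim2] by blast
  have quot: "((\<lambda>s. (f (of_real s) - f 1) / (of_real s - 1)) \<longlongrightarrow> d) (at_left (1::real))"
    using filterlim_compose[OF _ lim2] d[unfolded has_field_derivative_iff] by blast
  have ineq: "(1 - (1 - r)\<^sup>2) * (norm (1 - cnj (f (of_real s)) * f a))\<^sup>2
       \<le> (1 - (norm (f a))\<^sup>2) * (2 * norm ((f (of_real s) - f 1) / (of_real s - 1))) * (norm (1 - of_real s * a))\<^sup>2"
    if s: "s \<in> {0<..<1}" for s :: real
  proof -
    define A B where "A = (1 - (1 - r)\<^sup>2) * (norm (1 - cnj (f (of_real s)) * f a))\<^sup>2"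
      and "B = (1 - (norm (f a))\<^sup>2) * (norm (1 - of_real s * a))\<^sup>2"
    have B0: "B \<ge> 0" unfolding B_def using f(2)[of a] na r by (auto simp: power_le_one)
    have "A * (1 - s\<^sup>2) \<le> B * (1 - (norm (f (of_real s)))\<^sup>2)"
      using Schwarz_Pick[OF f, of a "of_real s"] na r s
      by (simp add: A_def B_def mult_ac)
    \<comment> \<open>This is where the derivative enters: the defect of \<open>f\<close> at
      \<open>s\<close> is traded for the increment from \<open>1\<close>, which after division by
      \<open>1 - s\<close> is the norm of a difference quotient.\<close>
    moreover have "1 - (norm (f (of_real s)))\<^sup>2 \<le> 2 * norm (f (of_real s) - f 1)"
    proof -
      have n1: "norm (f (of_real s)) \<le> 1" using f(2)[of "of_real s"] s by auto
      have "1 - (norm (f (of_real s)))\<^sup>2 = (1 - norm (f (of_real s))) * (1 + norm (f (of_real s)))"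
        by (simp add: power2_eq_square algebra_simps)
      also have "\<dots> \<le> (1 - norm (f (of_real s))) * 2" using n1 by (intro mult_left_mono) auto
      also have "1 - norm (f (of_real s)) \<le> norm (f (of_real s) - f 1)"
        using norm_triangle_ineq3[of "f (of_real s)" "f 1"] \<alpha> by auto
      finally show ?thesis by simp
    qed
    ultimately have "A * (1 - s\<^sup>2) \<le> B * (2 * norm (f (of_real s) - f 1))"
      using B0 by (meson mult_left_mono order_trans)
    moreover have "norm (f (of_real s) - f 1) = norm ((f (of_real s) - f 1) / (of_real s - 1)) * (1 - s)"
    proof -
      have "norm (complex_of_real s - 1) = 1 - s"
        using s by (metis abs_minus_commute abs_of_pos diff_gt_0_iff_gt greaterThanLessThan_iff norm_of_real of_real_1 of_real_diff)
      then show ?thesis using s by (simp add: norm_divide)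
    qed
    ultimately have "A * (1 + s) * (1 - s) \<le> B * (2 * norm ((f (of_real s) - f 1) / (of_real s - 1))) * (1 - s)"
      by (simp add: power2_eq_square algebra_simps)
    then have "A * (1 + s) \<le> B * (2 * norm ((f (of_real s) - f 1) / (of_real s - 1)))"
      using s by simp
    moreover have "A \<ge> 0" unfolding A_def using r by (auto simp: power_le_one)
    ultimately have "A \<le> B * (2 * norm ((f (of_real s) - f 1) / (of_real s - 1)))"
      using s by (smt (verit) greaterThanLessThan_iff mult_less_cancel_left2)
    then show ?thesis by (simp add: A_def B_def mult_ac)
  qed
  have ev: "\<forall>\<^sub>F t in at_left (1::real). t \<in> {0<..<1}"
    by (rule eventually_at_leftI[of 0]) auto
  have "(1 - (1 - r)\<^sup>2) * (norm (1 - cnj (f 1) * f a))\<^sup>2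
       \<le> (1 - (norm (f a))\<^sup>2) * (2 * norm d) * (norm (1 - 1 * a))\<^sup>2"
    by (rule tendsto_le[OF _ _ _ eventually_mono[OF ev ineq]]; (intro tendsto_intros)?)
       (simp_all add: lim fcont quot)
  moreover have "norm (1 - cnj (f 1) * f a) = h"
  proof -
    have "cnj (f 1) * f 1 = 1" using \<alpha> by (metis complex_norm_square mult.commute of_real_1 power_one)
    then have "1 - cnj (f 1) * f a = cnj (f 1) * (f 1 - f a)" by (simp add: algebra_simps)
    then show ?thesis by (simp add: h_def norm_mult \<alpha>)
  qed
  moreover have "norm (1 - 1 * a) = r" using r by (simp add: a_def)
  ultimately have "(2 * r - r\<^sup>2) * h\<^sup>2 \<le> (1 - (norm (f a))\<^sup>2) * (2 * norm d) * r\<^sup>2"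
    by (simp add: power2_eq_square algebra_simps)
  \<comment> \<open>The defect at \<open>a\<close> is at most twice the quantity \<open>h\<close>
    being estimated. The right side becomes linear in \<open>h\<close>, so one factor
    \<open>h\<close> cancels; the constant \<open>4\<close> is this factor \<open>2\<close> times
    the one obtained at \<open>s\<close>.\<close>
  also have "1 - (norm (f a))\<^sup>2 \<le> 2 * h"
  proof -
    have n1: "norm (f a) \<le> 1" using f(2)[of a] na r by auto
    have "1 - (norm (f a))\<^sup>2 = (1 - norm (f a)) * (1 + norm (f a))"
      by (simp add: power2_eq_square algebra_simps)
    also have "\<dots> \<le> (1 - norm (f a)) * 2" using n1 by (intro mult_left_mono) auto
    also have "1 - norm (f a) \<le> h"
      using norm_triangle_ineq2[of "f 1" "f a"] \<alpha> by (auto simp: h_def)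
    finally show ?thesis by simp
  qed
  finally have "(2 * r - r\<^sup>2) * h\<^sup>2 \<le> 2 * h * (2 * norm d) * r\<^sup>2" by (simp add: mult_right_mono)
  moreover have "r * h\<^sup>2 \<le> (2 * r - r\<^sup>2) * h\<^sup>2"
    using r by (intro mult_right_mono) (auto simp: power2_eq_square)
  ultimately have "(r * h) * h \<le> (r * h) * (4 * norm d * r)" by (simp add: power2_eq_square algebra_simps)
  then have "h \<le> 4 * r * norm d" if "h > 0" using that r by (simp add: mult_ac)
  then have "h \<le> 4 * r * norm d" using h0 r by (cases "h > 0") auto
  then show ?thesis unfolding h_def a_def .
qed

text \<open>The Cayley transform \<open>k\<close> maps the right half plane to the disc and
  \<open>h 0\<close> to \<open>0\<close>, so Schwarz's lemma applies. The constant is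
  \<open>(1 + 1/2) / (1 - 1/2)\<close>. The shift by \<open>e\<close> makes real parts strictly
  positive, which keeps the denominator of \<open>k\<close> away from \<open>0\<close> even when
  \<open>Re (h 0) = 0\<close>.\<close>

lemma Harnack_half:
  assumes h: "h holomorphic_on ball 0 1" "\<And>z. norm z < 1 \<Longrightarrow> Re (h z) \<ge> 0" and z: "norm z \<le> 1/2"
  shows "norm (h z) \<le> 3 * norm (h 0)"
proof -
  have *: "norm (h z) \<le> 3 * norm (h 0) + 2 * e" if e: "e > 0" for e :: real
  proof -
    define c where "c = h 0 + of_real e"
    define k where "k w = (h w + of_real e - c) / (h w + of_real e + cnj c)" for w
    have c: "Re c > 0" using h(2)[of 0] e by (simp add: c_def)
    have k1: "norm (k w) < 1" and nz: "h w + of_real e + cnj c \<noteq> 0" if "norm w < 1" for w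
    proof -
      define u where "u = h w + of_real e"
      have u: "Re u > 0" using h(2)[OF that] e by (simp add: u_def)
      then have pos: "Re (u + cnj c) > 0" using c by simp
      then show "h w + of_real e + cnj c \<noteq> 0" unfolding u_def by fastforce
      have "(norm (u - c))\<^sup>2 < (norm (u + cnj c))\<^sup>2"
        using mult_pos_pos[OF u c] unfolding cmod_power2 by (simp add: power2_eq_square algebra_simps)
      then have "norm (u - c) < norm (u + cnj c)" by (rule power2_less_imp_less) simp
      then have "norm (u - c) / norm (u + cnj c) < 1" by (subst divide_less_eq_1_pos) (auto intro: le_less_trans[OF norm_ge_zero])
      then show "norm (k w) < 1" unfolding k_def u_def norm_divide .
    qed
    have "norm (k z) \<le> norm z"
    proof (rule Schwarz_Lemma(1))
      show "k holomorphic_on ball 0 1" unfolding k_def using nz by (intro holomorphic_intros h) auto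
      show "k 0 = 0" by (simp add: k_def c_def)
    qed (use k1 z in auto)
    then have "norm (h z + of_real e - c) \<le> 1/2 * norm (h z + of_real e + cnj c)"
    proof -
      have "norm (h z + of_real e - c) / norm (h z + of_real e + cnj c) \<le> 1/2"
        using \<open>norm (k z) \<le> norm z\<close> z unfolding k_def norm_divide by linarith
      moreover have "norm (h z + of_real e + cnj c) > 0" using nz[of z] z by simp
      ultimately show ?thesis by (subst (asm) pos_divide_le_eq) auto
    qed
    moreover have "norm (h z) \<le> norm (h z + of_real e - c) + norm (h 0)"
      using norm_triangle_ineq[of "h z + of_real e - c" "h 0"] by (simp add: c_def algebra_simps)
    moreover have "norm (h z + of_real e + cnj c) \<le> norm (h z) + norm (h 0) + 2 * e"
    proof -
      have "h z + of_real e + cnj c = h z + cnj (h 0) + of_real (2 * e)" by (simp add: c_def)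
      also have "norm \<dots> \<le> norm (h z) + norm (cnj (h 0)) + norm (complex_of_real (2 * e))"
        by (intro norm_triangle_le add_mono norm_triangle_ineq) auto
      finally show ?thesis using e by (simp add: norm_mult)
    qed
    ultimately show ?thesis by simp
  qed
  show ?thesis
  proof (rule field_le_epsilon)
    fix e :: real assume "e > 0" then show "norm (h z) \<le> 3 * norm (h 0) + e" using *[of "e/2"] by auto
  qed
qed

section \<open>Rational inner functions\<close>

lemma poly2_holomorphic [holomorphic_intros]:
  assumes "u holomorphic_on S" "v holomorphic_on S"
  shows "(\<lambda>x. poly2 p (u x, v x)) holomorphic_on S"
  unfolding poly2_altdef fst_conv snd_conv by (intro holomorphic_intros assms)

lemma poly2_has_derivative:
  "\<exists>a b. (poly2 p has_derivative (\<lambda>h. a * fst h + b * snd h)) (at z within S)"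
proof -
  let ?P = "\<lambda>f. \<exists>a b. (f has_derivative (\<lambda>h. a * fst h + b * snd h)) (at z within S)"
  have sum: "?P (\<lambda>z. \<Sum>i\<in>A. f i z)" if "\<And>i. i \<in> A \<Longrightarrow> ?P (f i)"
    for A :: "nat set" and f :: "nat \<Rightarrow> complex \<times> complex \<Rightarrow> complex"
  proof -
    from that obtain a b
      where "\<And>i. i \<in> A \<Longrightarrow> (f i has_derivative (\<lambda>h. a i * fst h + b i * snd h)) (at z within S)"
      by metis
    then have "((\<lambda>z. \<Sum>i\<in>A. f i z) has_derivative (\<lambda>h. \<Sum>i\<in>A. a i * fst h + b i * snd h)) (at z within S)"
      by (rule has_derivative_sum)
    also have "(\<lambda>h. \<Sum>i\<in>A. a i * fst h + b i * snd h) = (\<lambda>h. sum a A * fst h + sum b A * snd h)"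
      by (simp add: sum.distrib sum_distrib_right)
    finally show ?thesis by blast
  qed
  have "?P (\<lambda>z. c * fst z ^ i * snd z ^ j)" for c :: complex and i j
  proof -
    have "((\<lambda>z. c * fst z ^ i * snd z ^ j) has_derivative
      (\<lambda>h. (c * (of_nat i * fst z ^ (i - 1)) * snd z ^ j) * fst h +
           (c * fst z ^ i * (of_nat j * snd z ^ (j - 1))) * snd h)) (at z within S)"
      by (auto intro!: derivative_eq_intros simp: algebra_simps)
    then show ?thesis by blast
  qed
  then show ?thesis
    unfolding poly2_altdef[abs_def] by (intro sum)
qed

lemma poly2_continuous: "continuous_on S (poly2 p)"
  using poly2_has_derivative has_derivative_continuous
  by (metis continuous_on_eq_continuous_within)

lemma rif_has_derivative:
  assumes "poly2 p z \<noteq> 0"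
  shows "\<exists>a b. (rif p has_derivative (\<lambda>h. a * fst h + b * snd h)) (at z within S)"
proof -
  obtain a b where ab: "(poly2 p has_derivative (\<lambda>h. a * fst h + b * snd h)) (at z within S)"
    using poly2_has_derivative by blast
  obtain c d where cd: "(poly2 (reflect2 p) has_derivative (\<lambda>h. c * fst h + d * snd h)) (at z within S)"
    using poly2_has_derivative by blast
  let ?q = "poly2 (reflect2 p) z" and ?p = "poly2 p z"
  have "(rif p has_derivative (\<lambda>h. (c * ?p - a * ?q) / ?p\<^sup>2 * fst h + (d * ?p - b * ?q) / ?p\<^sup>2 * snd h))
    (at z within S)"
    unfolding rif_def[abs_def]
    by (rule has_derivative_eq_rhs[OF has_derivative_divide'[OF cd ab assms]])
       (use assms in \<open>auto simp: fun_eq_iff field_simps power2_eq_square\<close>)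
  then show ?thesis by blast
qed

lemma rif_isCont: "poly2 p z \<noteq> 0 \<Longrightarrow> isCont (rif p) z"
  using rif_has_derivative has_derivative_continuous by blast

lemma rif_slice_holomorphic:
  assumes "u holomorphic_on S" "v holomorphic_on S" "\<And>x. x \<in> S \<Longrightarrow> poly2 p (u x, v x) \<noteq> 0"
  shows "(\<lambda>x. rif p (u x, v x)) holomorphic_on S"
  unfolding rif_def by (intro holomorphic_intros assms)

text \<open>Reflection exchanges the tori of radii \<open>1 / r\<close> and \<open>r\<close>,
  because \<open>1 / cnj (z / r) = r * z\<close> on the unit circle. The case \<open>r = 1\<close>
  gives unimodular boundary values; \<open>r < 1\<close> serves the dilated polynomial
  \<open>p (r z)\<close>.\<close>

lemma norm_poly2_reflect2_torus:
  assumes "0 < r" "norm z1 = 1" "norm z2 = 1"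
  shows "norm (poly2 (reflect2 p) (z1 / of_real r, z2 / of_real r)) * r ^ (degree1 p + degree2 p) =
    norm (poly2 p (of_real r * z1, of_real r * z2))"
proof -
  have inv: "1 / cnj (z / of_real r) = of_real r * z" if "norm z = 1" for z
  proof -
    have "z * cnj z = 1" using that by (metis complex_norm_square of_real_1 power_one)
    then have "1 / cnj z = z" by (metis div_by_1 divide_divide_eq_right mult_1 mult_zero_right nonzero_mult_div_cancel_right zero_neq_one)
    then show ?thesis using assms(1) by (simp add: divide_simps)
  qed
  have "z1 \<noteq> 0" "z2 \<noteq> 0" using assms by auto
  then have "poly2 (reflect2 p) (z1 / of_real r, z2 / of_real r) =
    (z1 / of_real r) ^ degree1 p * (z2 / of_real r) ^ degree2 p * cnj (poly2 p (of_real r * z1, of_real r * z2))"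
    using assms by (subst poly2_reflect2) (simp_all only: inv, auto)
  then show ?thesis using assms by (simp add: norm_mult norm_divide norm_power power_divide power_add)
qed

lemma norm_rif_torus:
  assumes "norm z1 = 1" "norm z2 = 1" "poly2 p (z1, z2) \<noteq> 0"
  shows "norm (rif p (z1, z2)) = 1"
  using norm_poly2_reflect2_torus[of 1 z1 z2 p] assms by (simp add: rif_def norm_divide)

text \<open>A bound on the torus alone, a small part of the topological boundary, suffices: the
  one-variable principle is applied in \<open>z\<close> for each \<open>w\<close> on the circle, and
  then in \<open>w\<close>.\<close>

lemma bidisc_maximum_modulus:
  assumes "\<And>w. norm w \<le> 1 \<Longrightarrow> (\<lambda>z. F z w) holomorphic_on cball 0 1"
    and "\<And>z. norm z \<le> 1 \<Longrightarrow> (\<lambda>w. F z w) holomorphic_on cball 0 1"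
    and "\<And>z w. norm z = 1 \<Longrightarrow> norm w = 1 \<Longrightarrow> norm (F z w) \<le> B"
    and "norm z \<le> 1" "norm w \<le> 1"
  shows "norm (F z w) \<le> B"
proof -
  have disc: "norm (f z) \<le> B"
    if "f holomorphic_on cball 0 1" "\<And>z. norm z = 1 \<Longrightarrow> norm (f z) \<le> B" "norm z \<le> 1" for f z
    by (rule maximum_modulus_frontier[of f "cball 0 1"])
       (use that holomorphic_on_imp_continuous_on holomorphic_on_subset[OF that(1)] in auto)
  show ?thesis
    by (rule disc[of "\<lambda>w. F z w"]) (use assms disc[of "\<lambda>z. F z _"] in auto)
qed

text \<open>Apply the maximum principle to the rational inner function of \<open>p(r z)\<close>, which has no
  singularities on the closed bidisc, and let \<open>r\<close> tend to \<open>1\<close>.\<close>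

lemma norm_rif_le_1:
  assumes "stable p" "norm z1 < 1" "norm z2 < 1"
  shows "norm (rif p (z1, z2)) \<le> 1"
proof -
  define N where "N = degree1 p + degree2 p"
  \<comment> \<open>The factor \<open>r ^ N\<close> turns the numerator into the reflection of
    \<open>p (r z)\<close>, so \<open>F r\<close> is unimodular on the torus; its denominator has no
    zero on the closed bidisc because \<open>p\<close> has none in the open one.\<close>
  define F where "F r z w = of_real r ^ N * poly2 (reflect2 p) (z / of_real r, w / of_real r) /
    poly2 p (of_real r * z, of_real r * w)" for r :: real and z w
  have ev: "\<forall>\<^sub>F r in at_left (1::real). r \<in> {0<..<1}"
    by (rule eventually_at_leftI[of 0]) auto
  have bd: "norm (F r z1 z2) \<le> 1" if r: "r \<in> {0<..<1}" for r
  proof (rule bidisc_maximum_modulus[where F = "F r"])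
    have lt: "norm (of_real r * z) < 1" if "norm z \<le> 1" for z :: complex
    proof -
      have "r * norm z \<le> r * 1" using r that by (intro mult_left_mono) auto
      also have "\<dots> < 1" using r by simp
      finally show ?thesis using r by (simp add: norm_mult)
    qed
    have nz: "poly2 p (of_real r * z, of_real r * w) \<noteq> 0" if "norm z \<le> 1" "norm w \<le> 1" for z w
      using assms(1) lt[OF that(1)] lt[OF that(2)] by (auto simp: stable_def bidisc_def)
    show "(\<lambda>z. F r z w) holomorphic_on cball 0 1" if "norm w \<le> 1" for w
      unfolding F_def by (intro holomorphic_intros) (use nz that r in auto)
    show "(\<lambda>w. F r z w) holomorphic_on cball 0 1" if "norm z \<le> 1" for z
      unfolding F_def by (intro holomorphic_intros) (use nz that r in auto)
    show "norm (F r z w) \<le> 1" if "norm z = 1" "norm w = 1" for z w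
    proof -
      have "norm (poly2 p (of_real r * z, of_real r * w)) > 0" using nz[of z w] that by simp
      then show ?thesis using norm_poly2_reflect2_torus[of r z w p] that r
        by (simp add: F_def norm_mult norm_divide norm_power N_def mult.commute)
    qed
  qed (use assms in auto)
  have lim: "((\<lambda>t. of_real t) \<longlongrightarrow> (1::complex)) (at_left 1)"
    using tendsto_of_real[OF tendsto_ident_at, of "1::real"] by auto
  have lim_poly2: "((\<lambda>x. poly2 q (u x, v x)) \<longlongrightarrow> poly2 q (a, b)) (at_left (1::real))"
    if "(u \<longlongrightarrow> a) (at_left 1)" "(v \<longlongrightarrow> b) (at_left 1)" for q u v a b
    using continuous_on_tendsto_compose[OF poly2_continuous[of UNIV q] tendsto_Pair[OF that]] by simp
  have "poly2 p (z1, z2) \<noteq> 0" using assms by (auto simp: stable_def bidisc_def)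
  then have "((\<lambda>r. F r z1 z2) \<longlongrightarrow> 1 ^ N * poly2 (reflect2 p) (z1 / 1, z2 / 1) / poly2 p (1 * z1, 1 * z2)) (at_left 1)"
    unfolding F_def by (intro tendsto_intros lim lim_poly2) auto
  then have "((\<lambda>r. norm (F r z1 z2)) \<longlongrightarrow> norm (rif p (z1, z2))) (at_left 1)"
    by (intro tendsto_norm) (simp add: rif_def)
  then show ?thesis
    by (rule tendsto_upperbound[OF _ eventually_mono[OF ev bd]]) auto
qed

text \<open>Along the slice through \<open>(\<zeta>, \<eta>)\<close> and the origin the derivative
  at the boundary is \<open>a * \<zeta> + b * \<eta>\<close>, and Julia's lemma gives the factor
  \<open>4\<close> at the centre of the polydisc. Harnack's inequality contributes the remaining
  factor \<open>3\<close>.\<close>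

lemma rif_near_boundary_point:
  assumes p: "stable p" and \<zeta>: "norm \<zeta> = 1" "norm \<eta> = 1" and nz: "poly2 p (\<zeta>, \<eta>) \<noteq> 0"
    and D: "(rif p has_derivative (\<lambda>h. a * fst h + b * snd h)) (at (\<zeta>, \<eta>))"
    and r: "0 < r" "r < 1"
    and z: "norm (z1 - of_real (1 - r) * \<zeta>) \<le> r / 2" "norm (z2 - of_real (1 - r) * \<eta>) \<le> r / 2"
  shows "norm (rif p (\<zeta>, \<eta>) - rif p (z1, z2)) \<le> 12 * r * norm (a * \<zeta> + b * \<eta>)"
proof -
  define \<alpha> where "\<alpha> = rif p (\<zeta>, \<eta>)"
  have \<alpha>: "norm \<alpha> = 1" unfolding \<alpha>_def by (rule norm_rif_torus) fact+
  have nz': "poly2 p (u, v) \<noteq> 0" if "norm u < 1" "norm v < 1" for u v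
    using p that by (auto simp: stable_def bidisc_def)
  define F where "F x = rif p (x * \<zeta>, x * \<eta>)" for x
  define c d where "c = of_real (1 - r) * \<zeta>" and "d = of_real (1 - r) * \<eta>"
  have "(F has_derivative (\<lambda>h. a * (h * \<zeta>) + b * (h * \<eta>))) (at 1)"
  proof -
    have "((\<lambda>x. (x * \<zeta>, x * \<eta>)) has_derivative (\<lambda>h. (h * \<zeta>, h * \<eta>))) (at 1)"
      by (auto intro!: derivative_eq_intros)
    moreover have "(rif p has_derivative (\<lambda>h. a * fst h + b * snd h)) (at (1 * \<zeta>, 1 * \<eta>))"
      using D by simp
    ultimately have "((\<lambda>x. rif p (x * \<zeta>, x * \<eta>)) has_derivative (\<lambda>h. a * fst (h * \<zeta>, h * \<eta>) + b * snd (h * \<zeta>, h * \<eta>))) (at 1)"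
      by (rule has_derivative_compose)
    then show ?thesis by (simp add: F_def[abs_def])
  qed
  also have "(\<lambda>h. a * (h * \<zeta>) + b * (h * \<eta>)) = (*) (a * \<zeta> + b * \<eta>)" by (auto simp: fun_eq_iff algebra_simps)
  finally have dF: "(F has_field_derivative (a * \<zeta> + b * \<eta>)) (at 1)"
    by (simp add: has_field_derivative_def)
  have "norm (F 1 - F (of_real (1 - r))) \<le> 4 * r * norm (a * \<zeta> + b * \<eta>)"
  proof (rule Julia_radial[OF _ _ dF _ r])
    show "F holomorphic_on ball 0 1"
      unfolding F_def by (intro rif_slice_holomorphic holomorphic_intros nz') (auto simp: norm_mult \<zeta>)
    show "norm (F z) \<le> 1" if "norm z < 1" for z
      unfolding F_def by (rule norm_rif_le_1[OF p]) (auto simp: norm_mult \<zeta> that)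
    show "norm (F 1) = 1" using \<alpha> by (simp add: F_def \<alpha>_def)
  qed
  then have J: "norm (\<alpha> - rif p (c, d)) \<le> 4 * r * norm (a * \<zeta> + b * \<eta>)"
    by (simp only: F_def \<alpha>_def c_def d_def mult_1)
  \<comment> \<open>The displacement from the centre is doubled, so that the target point is reached
    at \<open>1/2\<close>. The whole slice stays in the polydisc of radius \<open>r\<close> about
    the centre, which still lies in the bidisc.\<close>
  define h where "h x = 1 - cnj \<alpha> * rif p (c + x * (2 * (z1 - c)), d + x * (2 * (z2 - d)))" for x
  have norm_h: "norm (1 - cnj \<alpha> * u) = norm (\<alpha> - u)" for u
  proof -
    have "cnj \<alpha> * \<alpha> = 1" using \<alpha> by (metis complex_norm_square mult.commute of_real_1 power_one)
    then have "1 - cnj \<alpha> * u = cnj \<alpha> * (\<alpha> - u)" by (simp add: algebra_simps)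
    then show ?thesis by (simp add: norm_mult \<alpha>)
  qed
  have ncd: "norm c = 1 - r" "norm d = 1 - r"
    using r \<zeta> by (simp_all add: c_def d_def norm_mult del: of_real_diff)
  have inside: "norm (c + x * (2 * (z1 - c))) < 1" "norm (d + x * (2 * (z2 - d))) < 1" if "norm x < 1" for x
  proof -
    have *: "norm (u + x * (2 * v)) < 1" if uv: "norm u = 1 - r" "norm v \<le> r / 2" for u v
    proof -
      have "norm (u + x * (2 * v)) \<le> norm u + norm x * (2 * norm v)"
        by (rule norm_triangle_le) (simp add: norm_mult)
      also have "norm x * (2 * norm v) \<le> norm x * r"
        using uv by (intro mult_left_mono) auto
      also have "norm x * r < 1 * r" using r \<open>norm x < 1\<close> by (intro mult_strict_right_mono)
      finally show ?thesis using uv by simp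
    qed
    show "norm (c + x * (2 * (z1 - c))) < 1" "norm (d + x * (2 * (z2 - d))) < 1"
      using *[OF ncd(1), of "z1 - c"] *[OF ncd(2), of "z2 - d"] z by (auto simp: c_def d_def)
  qed
  have "norm (h (1/2)) \<le> 3 * norm (h 0)"
  proof (rule Harnack_half)
    show "h holomorphic_on ball 0 1"
      unfolding h_def by (intro rif_slice_holomorphic holomorphic_intros nz') (use inside in auto)
    show "Re (h x) \<ge> 0" if "norm x < 1" for x
    proof -
      have "norm (cnj \<alpha> * rif p (c + x * (2 * (z1 - c)), d + x * (2 * (z2 - d)))) \<le> 1"
        using norm_rif_le_1[OF p inside[OF that]] by (simp add: norm_mult \<alpha>)
      then show ?thesis unfolding h_def
        using complex_Re_le_cmod[of "cnj \<alpha> * rif p (c + x * (2 * (z1 - c)), d + x * (2 * (z2 - d)))"] by simp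
    qed
  qed auto
  moreover have "h (1/2) = 1 - cnj \<alpha> * rif p (z1, z2)" "h 0 = 1 - cnj \<alpha> * rif p (c, d)"
    by (simp_all add: h_def diff_divide_distrib)
  ultimately have "norm (\<alpha> - rif p (z1, z2)) \<le> 3 * norm (\<alpha> - rif p (c, d))"
    by (simp only: norm_h)
  with J show ?thesis by (simp add: \<alpha>_def)
qed

text \<open>Needed for the uniqueness of non-tangential limits. Radial points lie in the region of
  aperture \<open>1\<close>: there both sides of the defining inequality equal the distance
  \<open>s\<close> to the circle.\<close>

lemma islimpt_approach_region:
  assumes "\<zeta> \<in> bitorus"
  shows "\<zeta> islimpt approach_region 1 \<zeta>"
  unfolding islimpt_approachable
proof (intro allI impI)
  fix e :: real assume e: "e > 0"
  define s where "s = min (e / 4) (1/2)"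
  have s: "0 < s" "s \<le> 1/2" "2 * s < e" using e by (auto simp: s_def)
  obtain u v where uv: "\<zeta> = (u, v)" "norm u = 1" "norm v = 1"
    using assms by (auto simp: bitorus_def)
  define x where "x = (of_real (1 - s) * u, of_real (1 - s) * v)"
  have n: "norm (of_real (1 - s) * w) = 1 - s" "dist (of_real (1 - s) * w) w = s" if "norm w = 1" for w :: complex
  proof -
    show "norm (of_real (1 - s) * w) = 1 - s" using s that by (simp add: norm_mult del: of_real_diff)
    have "of_real (1 - s) * w - w = - (of_real s * w)" by (simp add: algebra_simps)
    then show "dist (of_real (1 - s) * w) w = s" using s that by (simp add: dist_norm norm_mult)
  qed
  have "x \<in> approach_region 1 \<zeta>"
    unfolding approach_region_def x_def uv(1) bidisc_def using n[OF uv(2)] n[OF uv(3)] s by auto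
  moreover have "x \<noteq> \<zeta>" using n(2)[OF uv(2)] s by (auto simp: x_def uv(1))
  moreover have "dist x \<zeta> < e"
  proof -
    have "dist x \<zeta> \<le> s + s"
      unfolding x_def uv(1) dist_Pair_Pair n(2)[OF uv(2)] n(2)[OF uv(3)]
      using s by (intro order_trans[OF sqrt_sum_squares_le_sum]) auto
    then show ?thesis using s by simp
  qed
  ultimately show "\<exists>x'\<in>approach_region 1 \<zeta>. x' \<noteq> \<zeta> \<and> dist x' \<zeta> < e" by blast
qed

text \<open>Level sets are closures, so \<open>z\<close> itself need not carry the limit
  \<open>\<alpha>\<close>. If the value at \<open>z\<close> were different, it would differ from
  \<open>\<alpha>\<close> on a neighbourhood free of zeros of \<open>p\<close>, yet that
  neighbourhood contains a point with limit \<open>\<alpha>\<close>, where by continuity the limit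
  is the value.\<close>

lemma rif_level_set:
  assumes z: "z \<in> level_set (rif p) \<alpha>" and nz: "poly2 p z \<noteq> 0"
  shows "rif p z = \<alpha>"
proof (rule ccontr)
  assume neq: "rif p z \<noteq> \<alpha>"
  have "isCont (poly2 p) z"
    using poly2_continuous[of UNIV p] continuous_on_eq_continuous_at open_UNIV by blast
  then have "\<forall>\<^sub>F y in nhds z. poly2 p y \<noteq> 0"
    using nz by (simp add: continuous_at_imp_continuous_at_within isCont_def tendsto_imp_eventually_ne eventually_nhds_conv_at)
  moreover have "\<forall>\<^sub>F y in nhds z. rif p y \<noteq> \<alpha>"
    using rif_isCont[OF nz] neq by (simp add: isCont_def tendsto_imp_eventually_ne eventually_nhds_conv_at)
  ultimately have "\<forall>\<^sub>F y in nhds z. poly2 p y \<noteq> 0 \<and> rif p y \<noteq> \<alpha>" by eventually_elim auto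
  then obtain U where U: "open U" "z \<in> U" "\<And>y. y \<in> U \<Longrightarrow> poly2 p y \<noteq> 0 \<and> rif p y \<noteq> \<alpha>"
    unfolding eventually_nhds by blast
  obtain y where y: "y \<in> U" "y \<in> bitorus" "has_nontangential_limit (rif p) y \<alpha>"
    using z U unfolding level_set_def closure_iff_nhds_not_empty by blast
  have "(rif p \<longlongrightarrow> \<alpha>) (at y within approach_region 1 y)"
    using y(3) by (auto simp: has_nontangential_limit_def)
  moreover have "(rif p \<longlongrightarrow> rif p y) (at y within approach_region 1 y)"
    using rif_isCont[of p y] U(3)[OF y(1)] by (auto simp: isCont_def intro: tendsto_within_subset)
  ultimately have "rif p y = \<alpha>"
    using islimpt_approach_region[OF y(2)] by (meson tendsto_unique trivial_limit_within)
  then show False using U(3)[OF y(1)] by blast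
qed

lemma islimpt_torus: "\<zeta> \<in> torus \<Longrightarrow> \<zeta> islimpt (torus :: complex set)"
proof (rule connected_imp_perfect)
  have "(1::complex) \<in> torus" "(-1::complex) \<in> torus" by auto
  then show "torus \<noteq> {a}" for a :: complex
    by (metis singletonD one_neq_neg_one)
qed (auto simp: connected_sphere)

text \<open>A complex derivative can be computed along any set that accumulates at the point. This
  transfers information available only on the circle to the full derivative.\<close>

lemma deriv_0_if_constant_on_torus:
  assumes d: "(f has_field_derivative d) (at \<eta>)" and \<eta>: "\<eta> \<in> torus"
    and c: "\<forall>\<^sub>F w in at \<eta> within torus. f w = c" "f \<eta> = c"
  shows "d = 0"
proof -
  have "((\<lambda>w. (f w - f \<eta>) / (w - \<eta>)) \<longlongrightarrow> d) (at \<eta> within torus)"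
    using DERIV_subset[OF d, of torus] by (simp add: has_field_derivative_iff)
  moreover have "((\<lambda>w. (f w - f \<eta>) / (w - \<eta>)) \<longlongrightarrow> 0) (at \<eta> within torus)"
    by (rule tendsto_eventually) (use c in \<open>auto elim: eventually_mono\<close>)
  ultimately show ?thesis
    using islimpt_torus[OF \<eta>] by (meson tendsto_unique trivial_limit_within)
qed

section \<open>Branches of level sets\<close>

lemma deriv_undefined: "\<nexists>D. (f has_field_derivative D) (at x) \<Longrightarrow> deriv f x = (SOME D. False)"
  by (simp add: deriv_def)

text \<open>\<^const>\<open>deriv\<close> is the same junk value wherever the derivative does not exist, and \<^const>\<open>rif\<close> is
  \<open>0\<close> by division by zero at the zeros of \<open>p\<close>. Neither is compatible with a derivative that tends to
  infinity, so the hypothesis on the derivative already excludes singularities along the branch.\<close>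

lemma branch_regular:
  fixes p :: "complex poly poly" and g :: "complex \<Rightarrow> complex" and \<omega>1 :: complex and K :: real
  defines "D \<equiv> (\<lambda>\<zeta>. deriv (\<lambda>w. rif p (\<zeta>, w)) (g \<zeta>))"
  assumes K: "K > 0" and g: "g ` torus \<subseteq> torus"
    and \<Theta>: "(\<lambda>\<zeta>. inverse (norm (D \<zeta>))) \<in> \<Theta>[at \<omega>1 within torus](\<lambda>\<zeta>. dist \<zeta> \<omega>1 powr K)"
  shows "\<exists>C>0. \<forall>\<^sub>F \<zeta> in at \<omega>1 within torus.
    poly2 p (\<zeta>, g \<zeta>) \<noteq> 0 \<and> norm (D \<zeta>) \<le> C * dist \<zeta> \<omega>1 powr (-K)"
proof -
  define c0 :: complex where "c0 = (SOME D. False)"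
  obtain c1 where c1: "c1 > 0"
    "\<forall>\<^sub>F \<zeta> in at \<omega>1 within torus. norm (inverse (norm (D \<zeta>))) \<ge> c1 * norm (dist \<zeta> \<omega>1 powr K)"
    using landau_omega.bigE[OF bigthetaD2[OF \<Theta>]] .
  obtain c2 where c2: "c2 > 0"
    "\<forall>\<^sub>F \<zeta> in at \<omega>1 within torus. norm (inverse (norm (D \<zeta>))) \<le> c2 * norm (dist \<zeta> \<omega>1 powr K)"
    using landau_o.bigE[OF bigthetaD1[OF \<Theta>]] .
  \<comment> \<open>A reciprocal below \<open>m\<close> separates \<open>D \<zeta>\<close> from the
    junk value \<open>c0\<close>. If \<open>c0 = 0\<close>, no threshold is required for that, since
    \<open>D \<zeta>\<close> is shown to be nonzero separately, and \<open>1\<close> is an arbitrary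
    choice.\<close>
  define m where "m = (if c0 = 0 then 1 else inverse (norm c0))"
  have "m > 0" by (simp add: m_def)
  have "((\<lambda>\<zeta>. dist \<zeta> \<omega>1) \<longlongrightarrow> 0) (at \<omega>1 within torus)"
    using tendsto_dist[OF tendsto_ident_at[of \<omega>1 torus] tendsto_const[of \<omega>1]] by simp
  then have "((\<lambda>\<zeta>. dist \<zeta> \<omega>1 powr K) \<longlongrightarrow> 0 powr K) (at \<omega>1 within torus)"
    by (rule tendsto_powr2) (use K in auto)
  then have "((\<lambda>\<zeta>. c2 * dist \<zeta> \<omega>1 powr K) \<longlongrightarrow> c2 * 0) (at \<omega>1 within torus)"
    by (intro tendsto_intros) auto
  then have small: "\<forall>\<^sub>F \<zeta> in at \<omega>1 within torus. c2 * dist \<zeta> \<omega>1 powr K < m"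
    using \<open>m > 0\<close> by (auto intro: order_tendstoD)
  have ne: "\<forall>\<^sub>F \<zeta> in at \<omega>1 within torus. \<zeta> \<noteq> \<omega>1 \<and> \<zeta> \<in> torus"
    by (simp add: eventually_at_filter)
  have "\<forall>\<^sub>F \<zeta> in at \<omega>1 within torus.
    poly2 p (\<zeta>, g \<zeta>) \<noteq> 0 \<and> norm (D \<zeta>) \<le> inverse c1 * dist \<zeta> \<omega>1 powr (-K)"
    using c1(2) c2(2) small ne
  proof eventually_elim
    case (elim \<zeta>)
    define t where "t = dist \<zeta> \<omega>1 powr K"
    have t: "t > 0" using elim by (simp add: t_def)
    have lo: "inverse (norm (D \<zeta>)) \<ge> c1 * t" using elim by (simp add: t_def)
    have hi: "inverse (norm (D \<zeta>)) < m" using elim by (simp add: t_def)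
    have "c1 * t > 0" using c1 t by simp
    \<comment> \<open>As \<open>inverse 0 = 0\<close>, the positive lower bound rules out a
      vanishing derivative.\<close>
    then have D0: "D \<zeta> \<noteq> 0" using lo by auto
    have "D \<zeta> \<noteq> c0" using hi D0 by (auto simp: m_def)
    then obtain d where d: "((\<lambda>w. rif p (\<zeta>, w)) has_field_derivative d) (at (g \<zeta>))"
      using deriv_undefined unfolding D_def c0_def by blast
    have Dd: "D \<zeta> = d" unfolding D_def using d by (rule DERIV_imp_deriv)
    have "poly2 p (\<zeta>, g \<zeta>) \<noteq> 0"
    proof
      assume 0: "poly2 p (\<zeta>, g \<zeta>) = 0"
      \<comment> \<open>On the torus \<open>rif p\<close> has modulus \<open>1\<close> off the zeros
        of \<open>p\<close> and is \<open>0\<close> at them. Being continuous in \<open>w\<close> at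
        \<open>g \<zeta>\<close> with value \<open>0\<close>, it must vanish at all nearby points of
        the circle.\<close>
      have "d = 0"
      proof (rule deriv_0_if_constant_on_torus[OF d])
        show "g \<zeta> \<in> torus" using g elim by blast
        show "rif p (\<zeta>, g \<zeta>) = 0" using 0 by (simp add: rif_def)
        have "((\<lambda>w. norm (rif p (\<zeta>, w))) \<longlongrightarrow> 0) (at (g \<zeta>) within torus)"
          using tendsto_norm[OF DERIV_isCont[OF d, unfolded isCont_def]] 0
          by (auto simp: rif_def intro: tendsto_within_subset)
        then have "\<forall>\<^sub>F w in at (g \<zeta>) within torus. norm (rif p (\<zeta>, w)) < 1"
          by (auto intro: order_tendstoD)
        moreover have "\<forall>\<^sub>F w in at (g \<zeta>) within torus. w \<in> torus"
          by (simp add: eventually_at_filter)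
        ultimately show "\<forall>\<^sub>F w in at (g \<zeta>) within torus. rif p (\<zeta>, w) = 0"
        proof eventually_elim
          case (elim w)
          then show ?case using norm_rif_torus[of \<zeta> w p] \<open>\<zeta> \<noteq> \<omega>1 \<and> \<zeta> \<in> torus\<close>
            by (cases "poly2 p (\<zeta>, w) = 0") (auto simp: rif_def)
        qed
      qed
      with Dd D0 show False by simp
    qed
    moreover have "norm (D \<zeta>) \<le> inverse (c1 * t)"
      using le_imp_inverse_le[OF lo \<open>c1 * t > 0\<close>] by simp
    ultimately show ?case by (simp add: t_def powr_minus)
  qed
  then show ?thesis using c1(1) by (intro exI[of _ "inverse c1"]) auto
qed

lemma level_parametrization_branch:
  assumes "level_parametrization \<phi> \<alpha> \<tau>0 N g" "j < N"
  obtains h where "g j ` torus \<subseteq> torus" "h analytic_on torus - {\<tau>0}"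
    "\<And>\<zeta>. \<zeta> \<in> torus - {\<tau>0} \<Longrightarrow> h \<zeta> = g j \<zeta>"
    "\<And>\<zeta>. \<zeta> \<in> torus \<Longrightarrow> (\<zeta>, g j \<zeta>) \<in> level_set \<phi> \<alpha>"
proof -
  note par = assms(1)[unfolded level_parametrization_def]
  from spec[OF conjunct1[OF par], of j] assms(2)
  have "g j ` torus \<subseteq> torus \<and> (\<exists>h. h analytic_on torus - {\<tau>0} \<and> (\<forall>\<zeta>\<in>torus - {\<tau>0}. h \<zeta> = g j \<zeta>))"
    by (rule mp)
  then obtain h where g: "g j ` torus \<subseteq> torus"
    and h: "h analytic_on torus - {\<tau>0}" "\<forall>\<zeta>\<in>torus - {\<tau>0}. h \<zeta> = g j \<zeta>"
    by (elim conjE exE)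
  from conjunct2[OF par]
  obtain V where "level_set \<phi> \<alpha> = (\<Union>j<N. (\<lambda>\<zeta>. (\<zeta>, g j \<zeta>)) ` torus) \<union> V \<times> torus"
    by (elim conjE exE)
  moreover have "(\<lambda>\<zeta>. (\<zeta>, g j \<zeta>)) ` torus \<subseteq> (\<Union>j<N. (\<lambda>\<zeta>. (\<zeta>, g j \<zeta>)) ` torus)"
    using assms(2) by (intro UN_upper) simp
  ultimately have level: "(\<lambda>\<zeta>. (\<zeta>, g j \<zeta>)) ` torus \<subseteq> level_set \<phi> \<alpha>"
    by (simp only: le_supI1)
  show ?thesis
  proof (rule that[OF g h(1)])
    show "h \<zeta> = g j \<zeta>" if "\<zeta> \<in> torus - {\<tau>0}" for \<zeta> using h(2) that by (rule bspec)
    show "(\<zeta>, g j \<zeta>) \<in> level_set \<phi> \<alpha>" if "\<zeta> \<in> torus" for \<zeta>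
      using level imageI[OF that] by (rule subsetD)
  qed
qed

text \<open>Differentiating \<open>\<phi>(\<zeta>, g(\<zeta>)) = \<alpha>\<close> along the circle bounds \<open>\<partial>\<phi>/\<partial>z\<^sub>1\<close> by
  \<open>\<partial>\<phi>/\<partial>z\<^sub>2\<close>, because \<open>g\<close> has a bounded derivative near \<open>\<omega>\<^sub>1\<close>.\<close>

lemma rif_near_branch:
  assumes p: "stable p" and \<omega>1: "\<omega>1 \<in> torus" and \<tau>0: "\<tau>0 \<noteq> \<omega>1"
    and par: "level_parametrization (rif p) \<alpha> \<tau>0 N g" "j < N" and K: "K > 0"
    and \<Theta>: "(\<lambda>\<zeta>. inverse (norm (deriv (\<lambda>w. rif p (\<zeta>, w)) (g j \<zeta>))))
       \<in> \<Theta>[at \<omega>1 within torus](\<lambda>\<zeta>. dist \<zeta> \<omega>1 powr K)"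
  shows "\<exists>C>0. \<forall>\<^sub>F \<zeta> in at \<omega>1 within torus. \<forall>r z1 z2. 0 < r \<longrightarrow> r < 1 \<longrightarrow>
    norm (z1 - of_real (1 - r) * \<zeta>) \<le> r / 2 \<longrightarrow> norm (z2 - of_real (1 - r) * g j \<zeta>) \<le> r / 2 \<longrightarrow>
    norm (\<alpha> - rif p (z1, z2)) \<le> C * r * dist \<zeta> \<omega>1 powr (-K)"
proof -
  define D where "D \<zeta> = deriv (\<lambda>w. rif p (\<zeta>, w)) (g j \<zeta>)" for \<zeta>
  obtain h where g: "g j ` torus \<subseteq> torus" and h: "h analytic_on torus - {\<tau>0}"
    and hg: "\<And>\<zeta>. \<zeta> \<in> torus - {\<tau>0} \<Longrightarrow> h \<zeta> = g j \<zeta>"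
    and level: "\<And>\<zeta>. \<zeta> \<in> torus \<Longrightarrow> (\<zeta>, g j \<zeta>) \<in> level_set (rif p) \<alpha>"
    using level_parametrization_branch[OF par] by metis
  obtain C where C: "C > 0" and reg: "\<forall>\<^sub>F \<zeta> in at \<omega>1 within torus.
    poly2 p (\<zeta>, g j \<zeta>) \<noteq> 0 \<and> norm (D \<zeta>) \<le> C * dist \<zeta> \<omega>1 powr (-K)"
    using branch_regular[OF K g \<Theta>] unfolding D_def by blast
  define B where "B = norm (deriv h \<omega>1) + 1"
  have an: "h analytic_on {\<zeta>}" if "\<zeta> \<in> torus - {\<tau>0}" for \<zeta>
    using h that by (auto intro: analytic_on_subset)
  have "isCont (deriv h) \<omega>1"
    using analytic_deriv[OF an[of \<omega>1]] \<omega>1 \<tau>0 analytic_at_imp_isCont by auto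
  then have "\<forall>\<^sub>F \<zeta> in at \<omega>1 within torus. norm (deriv h \<zeta>) < B"
    unfolding isCont_def B_def
    by (intro order_tendstoD(2)[OF tendsto_norm[OF tendsto_within_subset[of _ _ _ UNIV]]]) auto
  with reg have "\<forall>\<^sub>F \<zeta> in at \<omega>1 within torus. norm (deriv h \<zeta>) < B \<and>
    poly2 p (\<zeta>, g j \<zeta>) \<noteq> 0 \<and> norm (D \<zeta>) \<le> C * dist \<zeta> \<omega>1 powr (-K)"
    by eventually_elim auto
  then obtain e0 where e0: "e0 > 0" "\<And>\<zeta>. \<zeta> \<in> torus \<Longrightarrow> \<zeta> \<noteq> \<omega>1 \<Longrightarrow> dist \<zeta> \<omega>1 < e0 \<Longrightarrow>
     norm (deriv h \<zeta>) < B \<and> poly2 p (\<zeta>, g j \<zeta>) \<noteq> 0 \<and> norm (D \<zeta>) \<le> C * dist \<zeta> \<omega>1 powr (-K)"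
    unfolding eventually_at by metis
  \<comment> \<open>Staying closer to \<open>\<omega>1\<close> than the puncture is makes
    \<open>h\<close> agree with the branch on a whole arc around \<open>\<zeta>\<close>, as
    differentiation along the circle requires.\<close>
  define e where "e = min e0 (dist \<tau>0 \<omega>1)"
  have e: "e > 0" using e0 \<tau>0 by (simp add: e_def)
  show ?thesis
  proof (intro exI[of _ "12 * ((B + 1) * C)"] conjI)
    show "12 * ((B + 1) * C) > 0" using C by (simp add: B_def add_pos_nonneg)
  next
    show "\<forall>\<^sub>F \<zeta> in at \<omega>1 within torus. \<forall>r z1 z2. 0 < r \<longrightarrow> r < 1 \<longrightarrow>
      norm (z1 - of_real (1 - r) * \<zeta>) \<le> r / 2 \<longrightarrow> norm (z2 - of_real (1 - r) * g j \<zeta>) \<le> r / 2 \<longrightarrow>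
      norm (\<alpha> - rif p (z1, z2)) \<le> 12 * ((B + 1) * C) * r * dist \<zeta> \<omega>1 powr (-K)"
      unfolding eventually_at
    proof (intro exI[of _ e] conjI ballI impI allI)
      fix \<zeta> :: complex and r z1 z2
      assume \<zeta>: "\<zeta> \<in> torus" "\<zeta> \<noteq> \<omega>1 \<and> dist \<zeta> \<omega>1 < e" and r: "0 < r" "r < 1"
        and z: "norm (z1 - of_real (1 - r) * \<zeta>) \<le> r / 2" "norm (z2 - of_real (1 - r) * g j \<zeta>) \<le> r / 2"
      have near: "\<zeta>' \<in> torus - {\<tau>0} \<and> h \<zeta>' = g j \<zeta>' \<and> poly2 p (\<zeta>', g j \<zeta>') \<noteq> 0 \<and> rif p (\<zeta>', g j \<zeta>') = \<alpha>"
        if "\<zeta>' \<in> torus" "\<zeta>' \<noteq> \<omega>1" "dist \<zeta>' \<omega>1 < e" for \<zeta>'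
        using that e0(2)[of \<zeta>'] hg[of \<zeta>'] rif_level_set[OF level, of \<zeta>'] by (auto simp: e_def)
      note at\<zeta> = near[of \<zeta>]
      obtain a b where ab: "(rif p has_derivative (\<lambda>h. a * fst h + b * snd h)) (at (\<zeta>, g j \<zeta>))"
        using rif_has_derivative at\<zeta> \<zeta> by blast
      have b: "b = D \<zeta>"
      proof -
        have "((\<lambda>w. (\<zeta>, w)) has_derivative (\<lambda>h. (0, h))) (at (g j \<zeta>))"
          by (auto intro!: derivative_eq_intros)
        from has_derivative_compose[OF this ab]
        have "((\<lambda>w. rif p (\<zeta>, w)) has_field_derivative b) (at (g j \<zeta>))"
          by (simp add: has_field_derivative_def)
        then show ?thesis unfolding D_def by (metis DERIV_imp_deriv)
      qed
      have "a + b * deriv h \<zeta> = 0"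
      proof (rule deriv_0_if_constant_on_torus)
        have "(h has_field_derivative deriv h \<zeta>) (at \<zeta>)"
          using an at\<zeta> \<zeta> by (meson analytic_on_imp_differentiable_at field_differentiable_derivI singletonI)
        then have "((\<lambda>x. (x, h x)) has_derivative (\<lambda>k. (k, deriv h \<zeta> * k))) (at \<zeta>)"
          by (auto simp: has_field_derivative_def intro!: derivative_eq_intros)
        moreover have "(rif p has_derivative (\<lambda>h. a * fst h + b * snd h)) (at (\<zeta>, h \<zeta>))"
          using ab at\<zeta> \<zeta> by simp
        ultimately have "((\<lambda>x. rif p (x, h x)) has_derivative (\<lambda>k. a * fst (k, deriv h \<zeta> * k) + b * snd (k, deriv h \<zeta> * k))) (at \<zeta>)"
          by (rule has_derivative_compose)
        also have "(\<lambda>k. a * fst (k, deriv h \<zeta> * k) + b * snd (k, deriv h \<zeta> * k)) = (*) (a + b * deriv h \<zeta>)"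
          by (auto simp: fun_eq_iff algebra_simps)
        finally show "((\<lambda>x. rif p (x, h x)) has_field_derivative a + b * deriv h \<zeta>) (at \<zeta>)"
          by (simp add: has_field_derivative_def)
        show "rif p (\<zeta>, h \<zeta>) = \<alpha>" using at\<zeta> \<zeta> by simp
        have "\<forall>\<^sub>F x in at \<zeta> within torus. x \<in> ball \<omega>1 e - {\<omega>1} \<and> x \<in> torus"
          using eventually_at_in_open'[of "ball \<omega>1 e - {\<omega>1}" \<zeta>] \<zeta>
          by (auto simp: eventually_at_filter dist_commute open_delete elim!: eventually_mono)
        then show "\<forall>\<^sub>F x in at \<zeta> within torus. rif p (x, h x) = \<alpha>"
          by eventually_elim (use near in \<open>auto simp: dist_commute\<close>)
      qed (use \<zeta> in auto)
      then have a: "a = - (b * deriv h \<zeta>)" by (simp add: eq_neg_iff_add_eq_0)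
      have g\<zeta>: "norm \<zeta> = 1" "norm (g j \<zeta>) = 1" using g \<zeta>(1) by (auto simp: image_subset_iff)
      have "norm (a * \<zeta> + b * g j \<zeta>) \<le> norm (a * \<zeta>) + norm (b * g j \<zeta>)" by (rule norm_triangle_ineq)
      also have "\<dots> = norm (D \<zeta>) * (norm (deriv h \<zeta>) + 1)"
        by (simp add: a b g\<zeta> norm_mult algebra_simps)
      also have "\<dots> \<le> (C * dist \<zeta> \<omega>1 powr (-K)) * (B + 1)"
      proof (rule mult_mono)
        have "dist \<zeta> \<omega>1 < e0" using \<zeta> by (simp add: e_def)
        with e0(2)[of \<zeta>] \<zeta> show "norm (D \<zeta>) \<le> C * dist \<zeta> \<omega>1 powr (-K)" "norm (deriv h \<zeta>) + 1 \<le> B + 1"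
          by auto
      qed (use C in auto)
      finally have bd: "norm (a * \<zeta> + b * g j \<zeta>) \<le> (C * dist \<zeta> \<omega>1 powr (-K)) * (B + 1)" .
      have "norm (\<alpha> - rif p (z1, z2)) \<le> 12 * r * norm (a * \<zeta> + b * g j \<zeta>)"
      proof -
        have "poly2 p (\<zeta>, g j \<zeta>) \<noteq> 0" "rif p (\<zeta>, g j \<zeta>) = \<alpha>" using at\<zeta> \<zeta> by blast+
        with rif_near_boundary_point[OF p g\<zeta> _ ab r z] show ?thesis by simp
      qed
      also have "\<dots> \<le> 12 * r * ((C * dist \<zeta> \<omega>1 powr (-K)) * (B + 1))"
        using r by (intro mult_left_mono[OF bd]) auto
      finally show "norm (\<alpha> - rif p (z1, z2)) \<le> 12 * ((B + 1) * C) * r * dist \<zeta> \<omega>1 powr (-K)"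
        by (simp only: mult_ac)
    qed (rule e)
  qed
qed

section \<open>Integrals of kernels over the disc\<close>

text \<open>Lebesgue measure is determined by its values on boxes. The identification makes
  Tonelli's theorem in Cartesian coordinates available for integrals over the disc.\<close>

lemma lborel_complex: "(lborel :: complex measure) = distr (lborel \<Otimes>\<^sub>M lborel) borel (\<lambda>(x, y). Complex x y)"
proof (rule lborel_eqI)
  have cont: "continuous_on UNIV (\<lambda>(x, y). Complex x y)"
    unfolding Complex_eq case_prod_beta by (intro continuous_intros)
  then have [measurable]: "(\<lambda>(x, y). Complex x y) \<in> borel_measurable (lborel \<Otimes>\<^sub>M lborel)"
    unfolding lborel_prod by (simp add: borel_measurable_continuous_onI)
  fix l u :: complex assume lu: "\<And>b. b \<in> Basis \<Longrightarrow> l \<bullet> b \<le> u \<bullet> b"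
  have le: "Re l \<le> Re u" "Im l \<le> Im u" using lu[of 1] lu[of \<i>] by (simp_all add: Basis_complex_def)
  have "(\<lambda>(x, y). Complex x y) -` box l u \<inter> space (lborel \<Otimes>\<^sub>M lborel) = box (Re l) (Re u) \<times> box (Im l) (Im u)"
    by (auto simp: box_def Basis_complex_def space_pair_measure)
  then have "emeasure (distr (lborel \<Otimes>\<^sub>M lborel) borel (\<lambda>(x, y). Complex x y)) (box l u) =
    emeasure (lborel \<Otimes>\<^sub>M lborel) (box (Re l) (Re u) \<times> box (Im l) (Im u))"
    by (subst emeasure_distr) auto
  also have "\<dots> = ennreal ((Re u - Re l) * (Im u - Im l))"
    using le by (subst lborel.emeasure_pair_measure_Times) (auto simp: ennreal_mult)
  also have "(Re u - Re l) * (Im u - Im l) = (\<Prod>b\<in>Basis. (u - l) \<bullet> b)"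
    by (simp add: Basis_complex_def)
  finally show "emeasure (distr (lborel \<Otimes>\<^sub>M lborel) borel (\<lambda>(x, y). Complex x y)) (box l u) =
    (\<Prod>b\<in>Basis. (u - l) \<bullet> b)" .
qed simp

lemma Complex_measurable [measurable]: "(\<lambda>(x, y). Complex x y) \<in> borel_measurable (borel \<Otimes>\<^sub>M borel)"
proof -
  have "continuous_on UNIV (\<lambda>(x, y). Complex x y)"
    unfolding Complex_eq case_prod_beta by (intro continuous_intros)
  then show ?thesis unfolding borel_prod by (simp add: borel_measurable_continuous_onI)
qed

text \<open>Both orders are used later: the inner variable is the coordinate whose absolute value
  exceeds \<open>1/2\<close>, so that lines in its direction cross the circle transversally.\<close>

lemma nn_integral_lborel_complex:
  assumes [measurable]: "f \<in> borel_measurable borel"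
  shows "(\<integral>\<^sup>+z. f z \<partial>lborel) = (\<integral>\<^sup>+y. \<integral>\<^sup>+x. f (Complex x y) \<partial>lborel \<partial>lborel)"
    and "(\<integral>\<^sup>+z. f z \<partial>lborel) = (\<integral>\<^sup>+x. \<integral>\<^sup>+y. f (Complex x y) \<partial>lborel \<partial>lborel)"
proof -
  have *: "(\<integral>\<^sup>+z. f z \<partial>lborel) = (\<integral>\<^sup>+(x, y). f (Complex x y) \<partial>(lborel \<Otimes>\<^sub>M lborel))"
    by (subst lborel_complex, subst nn_integral_distr) (auto simp: case_prod_beta')
  have m: "(\<lambda>(x, y). f (Complex x y)) \<in> borel_measurable (lborel \<Otimes>\<^sub>M lborel)"
    using measurable_compose[OF Complex_measurable assms] by (simp add: case_prod_beta')
  show "(\<integral>\<^sup>+z. f z \<partial>lborel) = (\<integral>\<^sup>+x. \<integral>\<^sup>+y. f (Complex x y) \<partial>lborel \<partial>lborel)"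
    unfolding * using lborel.nn_integral_fst[OF m] by simp
  show "(\<integral>\<^sup>+z. f z \<partial>lborel) = (\<integral>\<^sup>+y. \<integral>\<^sup>+x. f (Complex x y) \<partial>lborel \<partial>lborel)"
    unfolding * using lborel_pair.nn_integral_snd[OF m] by simp
qed

text \<open>The integral is split at \<open>s = \<delta>\<close>: below, the denominator is at least
  \<open>\<delta> ^ n\<close>, above, at least \<open>s ^ n\<close>. Both parts scale alike;
  \<open>\<beta> > -1\<close> gives convergence at \<open>0\<close> and
  \<open>n > \<beta> + 1\<close> at infinity.\<close>

lemma nn_integral_powr_kernel:
  assumes "\<beta> > -1" "real n > \<beta> + 1" "\<delta> > 0"
  shows "(\<integral>\<^sup>+s. ennreal (indicator {0..} s * (s powr \<beta> / (\<delta> + s) ^ n)) \<partial>lborel)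
    \<le> ennreal ((1 / (\<beta> + 1) + 1 / (real n - \<beta> - 1)) * \<delta> powr (\<beta> + 1 - real n))"
proof -
  have "(\<integral>\<^sup>+s. ennreal (indicator {0..} s * (s powr \<beta> / (\<delta> + s) ^ n)) \<partial>lborel) \<le>
    (\<integral>\<^sup>+s. ennreal (\<delta> powr (- real n)) * ennreal (indicator {0..\<delta>} s * s powr \<beta>) +
      ennreal (indicator {\<delta>..} s * s powr (\<beta> - real n)) \<partial>lborel)"
  proof (rule nn_integral_mono)
    fix s :: real
    have 1: "s powr \<beta> / (\<delta> + s) ^ n \<le> \<delta> powr (- real n) * s powr \<beta>" if "0 \<le> s"
    proof -
      have "s powr \<beta> / (\<delta> + s) ^ n \<le> s powr \<beta> / \<delta> ^ n"
        using that assms by (intro divide_left_mono power_mono mult_pos_pos) auto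
      also have "\<dots> = \<delta> powr (- real n) * s powr \<beta>"
        using assms by (simp add: powr_minus powr_realpow field_simps)
      finally show ?thesis .
    qed
    have 2: "s powr \<beta> / (\<delta> + s) ^ n \<le> s powr (\<beta> - real n)" if "\<delta> \<le> s"
    proof -
      have "s powr \<beta> / (\<delta> + s) ^ n \<le> s powr \<beta> / s ^ n"
        using that assms by (intro divide_left_mono power_mono mult_pos_pos) auto
      also have "\<dots> = s powr (\<beta> - real n)"
        using assms that by (simp add: powr_diff powr_realpow)
      finally show ?thesis .
    qed
    consider "s < 0" | "0 \<le> s" "s \<le> \<delta>" | "s > \<delta>" "s > 0" using assms by linarith
    then show "ennreal (indicator {0..} s * (s powr \<beta> / (\<delta> + s) ^ n)) \<le>
      ennreal (\<delta> powr (- real n)) * ennreal (indicator {0..\<delta>} s * s powr \<beta>) +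
      ennreal (indicator {\<delta>..} s * s powr (\<beta> - real n))"
    proof cases
      case 2
      then show ?thesis using 1
        by (intro order_trans[OF _ add_increasing2[OF _ order_refl]]) (auto simp: ennreal_mult[symmetric] intro!: ennreal_leI)
    next
      case 3
      then show ?thesis using 2 by (auto intro!: ennreal_leI)
    qed auto
  qed
  also have "\<dots> = ennreal (\<delta> powr (- real n)) * (\<integral>\<^sup>+s. ennreal (indicator {0..\<delta>} s * s powr \<beta>) \<partial>lborel) +
    (\<integral>\<^sup>+s. ennreal (indicator {\<delta>..} s * s powr (\<beta> - real n)) \<partial>lborel)"
    by (subst nn_integral_add) (auto simp: nn_integral_cmult)
  also have "(\<integral>\<^sup>+s. ennreal (indicator {0..\<delta>} s * s powr \<beta>) \<partial>lborel) = ennreal (\<delta> powr (\<beta> + 1) / (\<beta> + 1))"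
    using nn_integral_has_integral_lebesgue[OF _ has_integral_powr_from_0[of \<beta> \<delta>]] assms by auto
  also have "(\<integral>\<^sup>+s. ennreal (indicator {\<delta>..} s * s powr (\<beta> - real n)) \<partial>lborel) =
    ennreal (- (\<delta> powr (\<beta> - real n + 1)) / (\<beta> - real n + 1))"
    using nn_integral_has_integral_lebesgue[OF _ has_integral_powr_to_inf[of "\<beta> - real n" \<delta>]] assms by auto
  also have "- (\<delta> powr (\<beta> - real n + 1)) / (\<beta> - real n + 1) = \<delta> powr (\<beta> + 1 - real n) / (real n - \<beta> - 1)"
    using assms by (simp add: field_simps)
  also have "ennreal (\<delta> powr (- real n)) * ennreal (\<delta> powr (\<beta> + 1) / (\<beta> + 1)) = ennreal (\<delta> powr (\<beta> + 1 - real n) / (\<beta> + 1))"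
    using assms by (simp add: ennreal_mult'[symmetric] powr_add[symmetric] algebra_simps)
  also have "ennreal (\<delta> powr (\<beta> + 1 - real n) / (\<beta> + 1)) + ennreal (\<delta> powr (\<beta> + 1 - real n) / (real n - \<beta> - 1)) =
    ennreal ((1 / (\<beta> + 1) + 1 / (real n - \<beta> - 1)) * \<delta> powr (\<beta> + 1 - real n))"
    using assms by (subst ennreal_plus[symmetric]) (auto simp: distrib_right)
  finally show ?thesis .
qed

lemma nn_integral_reflect:
  fixes f :: "real \<Rightarrow> ennreal"
  assumes [measurable]: "f \<in> borel_measurable borel"
  shows "(\<integral>\<^sup>+x. f (a - x) \<partial>lborel) = (\<integral>\<^sup>+x. f x \<partial>lborel)" "(\<integral>\<^sup>+x. f (a + x) \<partial>lborel) = (\<integral>\<^sup>+x. f x \<partial>lborel)"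
  using nn_integral_real_affine[of f "-1" a] nn_integral_real_affine[of f 1 a] by auto

text \<open>The cut-off at \<open>0\<close> allows a signed distance to the circle as the argument
  \<open>s\<close>, negative outside the disc.\<close>

definition powr_kernel :: "real \<Rightarrow> nat \<Rightarrow> real \<Rightarrow> real \<Rightarrow> real" where
  "powr_kernel \<beta> n \<delta> s = indicator {0..} s * (s powr \<beta> / (\<delta> + s) ^ n)"

lemma powr_kernel_measurable [measurable]: "powr_kernel \<beta> n \<delta> \<in> borel_measurable borel"
  unfolding powr_kernel_def[abs_def] by measurable

lemma powr_kernel_nonneg: "\<delta> > 0 \<Longrightarrow> powr_kernel \<beta> n \<delta> s \<ge> 0"
  by (auto simp: powr_kernel_def indicator_def)

text \<open>Uniformity in \<open>a\<close> is the point: later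
  \<open>a = sqrt (1 - y\<^sup>2)\<close> varies with the other coordinate. Each sign of
  \<open>x\<close> contributes at most one reflected or translated copy of the full
  integral.\<close>

lemma nn_integral_powr_kernel_abs:
  assumes "\<beta> > -1" "real n > \<beta> + 1" "\<delta> > 0"
  shows "(\<integral>\<^sup>+x. ennreal (powr_kernel \<beta> n \<delta> (a - \<bar>x\<bar>)) \<partial>lborel)
    \<le> ennreal (2 * (1 / (\<beta> + 1) + 1 / (real n - \<beta> - 1)) * \<delta> powr (\<beta> + 1 - real n))"
proof -
  let ?k = "\<lambda>s. ennreal (powr_kernel \<beta> n \<delta> s)"
  have "(\<integral>\<^sup>+x. ?k (a - \<bar>x\<bar>) \<partial>lborel) \<le> (\<integral>\<^sup>+x. ?k (a - x) + ?k (a + x) \<partial>lborel)"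
    by (intro nn_integral_mono) (auto simp: abs_if)
  also have "\<dots> = (\<integral>\<^sup>+x. ?k x \<partial>lborel) + (\<integral>\<^sup>+x. ?k x \<partial>lborel)"
    by (subst nn_integral_add) (auto simp: nn_integral_reflect[of ?k])
  also have "\<dots> \<le> ennreal ((1 / (\<beta> + 1) + 1 / (real n - \<beta> - 1)) * \<delta> powr (\<beta> + 1 - real n)) +
     ennreal ((1 / (\<beta> + 1) + 1 / (real n - \<beta> - 1)) * \<delta> powr (\<beta> + 1 - real n))"
    unfolding powr_kernel_def by (intro add_mono nn_integral_powr_kernel assms)
  also have "\<dots> = ennreal (2 * (1 / (\<beta> + 1) + 1 / (real n - \<beta> - 1)) * \<delta> powr (\<beta> + 1 - real n))"
    using assms by (subst ennreal_plus[symmetric]) (auto simp: algebra_simps)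
  finally show ?thesis .
qed

lemma nn_integral_inverse_power_abs:
  assumes "n \<ge> 2" "\<delta> > 0"
  shows "(\<integral>\<^sup>+y. ennreal (1 / (\<delta> + \<bar>y - b\<bar>) ^ n) \<partial>lborel)
    \<le> ennreal (2 * (1 + 1 / (real n - 1)) * \<delta> powr (1 - real n))"
proof -
  let ?k = "\<lambda>s. ennreal (powr_kernel 0 n \<delta> s)"
  \<comment> \<open>The point \<open>y = b\<close> has to be left out: there
    \<open>0 powr 0 = 0\<close> makes both kernels vanish, so they do not dominate the
    integrand.\<close>
  have "AE y in lborel. y \<noteq> b" by (rule AE_lborel_singleton)
  then have "(\<integral>\<^sup>+y. ennreal (1 / (\<delta> + \<bar>y - b\<bar>) ^ n) \<partial>lborel) \<le> (\<integral>\<^sup>+y. ?k (b - y) + ?k (-b + y) \<partial>lborel)"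
    by (intro nn_integral_mono_AE) (elim eventually_mono, auto simp: abs_if powr_kernel_def)
  also have "\<dots> = (\<integral>\<^sup>+x. ?k x \<partial>lborel) + (\<integral>\<^sup>+x. ?k x \<partial>lborel)"
    by (subst nn_integral_add) (auto simp: nn_integral_reflect(1)[of ?k] nn_integral_reflect(2)[of ?k "-b", simplified])
  also have "\<dots> \<le> ennreal ((1 / (0 + 1) + 1 / (real n - 0 - 1)) * \<delta> powr (0 + 1 - real n)) +
     ennreal ((1 / (0 + 1) + 1 / (real n - 0 - 1)) * \<delta> powr (0 + 1 - real n))"
    unfolding powr_kernel_def by (intro add_mono nn_integral_powr_kernel) (use assms in auto)
  also have "\<dots> = ennreal (2 * (1 + 1 / (real n - 1)) * \<delta> powr (1 - real n))"
    using assms by (subst ennreal_plus[symmetric]) (auto simp: algebra_simps)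
  finally show ?thesis .
qed

text \<open>The first two bounds hold because \<open>norm z * (1 - \<delta>)\<close> stays below
  \<open>1\<close>. For the third, the quantity inside the norm is
  \<open>cnj \<alpha> * (\<alpha> - z) + \<delta> * z * cnj \<alpha>\<close>; its last term is at
  most \<open>\<delta>\<close>, hence at most \<open>D\<close>, which explains the factor
  \<open>2\<close>.\<close>

lemma kernel_lower_bounds:
  fixes z \<alpha> :: complex
  assumes z: "norm z < 1" and \<alpha>: "norm \<alpha> = 1" and \<delta>: "0 < \<delta>" "\<delta> < 1"
  defines "D \<equiv> norm (1 - z * cnj (of_real (1 - \<delta>) * \<alpha>))"
  shows "\<delta> \<le> D" "1 - norm z \<le> D" "norm (z - \<alpha>) \<le> 2 * D"
proof -
  have "norm (z * cnj (of_real (1 - \<delta>) * \<alpha>)) = norm z * (1 - \<delta>)"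
    using \<delta> by (simp add: norm_mult \<alpha> del: of_real_diff)
  then have *: "1 - norm z * (1 - \<delta>) \<le> D"
    unfolding D_def by (metis norm_one norm_triangle_ineq2)
  have "norm z * (1 - \<delta>) \<le> 1 * (1 - \<delta>)" "norm z * (1 - \<delta>) \<le> norm z * 1"
    using z \<delta> by (intro mult_right_mono mult_left_mono; simp)+
  with * show "\<delta> \<le> D" "1 - norm z \<le> D" by auto
  have "cnj \<alpha> * \<alpha> = 1" using \<alpha> by (metis complex_norm_square mult.commute of_real_1 power_one)
  then have "cnj \<alpha> * (\<alpha> - z) = (1 - z * cnj (of_real (1 - \<delta>) * \<alpha>)) - of_real \<delta> * z * cnj \<alpha>"
    by (simp add: algebra_simps)
  then have "norm (cnj \<alpha> * (\<alpha> - z)) \<le> D + norm (of_real \<delta> * z * cnj \<alpha>)"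
    unfolding D_def by (simp only: norm_triangle_ineq4)
  then have "norm (\<alpha> - z) \<le> D + norm (of_real \<delta> * z * cnj \<alpha>)"
    by (simp add: norm_mult \<alpha>)
  also have "norm (of_real \<delta> * z * cnj \<alpha>) \<le> \<delta>"
    using z \<delta> \<alpha> by (simp add: norm_mult mult_left_le)
  finally show "norm (z - \<alpha>) \<le> 2 * D" using \<open>\<delta> \<le> D\<close> by (simp add: norm_minus_commute)
qed

text \<open>The bound is a product of a function of the distance \<open>sqrt (1 - y\<^sup>2) - \<bar>x\<bar>\<close> to the circle in the
  \<open>x\<close>-direction and a function of \<open>y\<close>, so that it can be integrated in Cartesian coordinates.\<close>

lemma kernel_bound_sector:
  fixes x y b D \<delta> \<beta> :: real
  assumes x: "\<bar>x\<bar> > 1/2" and xy: "x\<^sup>2 + y\<^sup>2 < 1" and \<delta>: "0 < \<delta>" "\<delta> < 1"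
    and D: "\<delta> \<le> D" "1 - sqrt (x\<^sup>2 + y\<^sup>2) \<le> D" "\<bar>y - b\<bar> \<le> 2 * D"
  shows "(1 - (x\<^sup>2 + y\<^sup>2)) powr \<beta> / D ^ (2 * n) \<le>
    max 1 (2 powr \<beta>) * 9 ^ n * (powr_kernel \<beta> n \<delta> (sqrt (1 - y\<^sup>2) - \<bar>x\<bar>) * (1 / (\<delta> + \<bar>y - b\<bar>) ^ n))"
proof -
  define a where "a = sqrt (1 - y\<^sup>2)"
  define s where "s = a - \<bar>x\<bar>"
  have y: "y\<^sup>2 < 1" using xy zero_le_power2[of x] by linarith
  have "\<bar>x\<bar> < a" unfolding a_def using xy by (intro real_less_rsqrt) auto
  then have s: "s > 0" by (simp add: s_def)
  have a1: "a \<le> 1" unfolding a_def by simp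
  have x1: "\<bar>x\<bar> < 1" using \<open>\<bar>x\<bar> < a\<close> a1 by simp
  \<comment> \<open>The weight base factors as
    \<open>(a - \<bar>x\<bar>) * (a + \<bar>x\<bar>)\<close>. Since
    \<open>a > \<bar>x\<bar> > 1/2\<close>, the second factor lies between \<open>1\<close> and
    \<open>2\<close>, so the weight is comparable to a power of \<open>s\<close> alone.\<close>
  have prod: "1 - (x\<^sup>2 + y\<^sup>2) = s * (a + \<bar>x\<bar>)"
    using y by (simp add: s_def a_def algebra_simps power2_eq_square[symmetric])
  have sum: "1 \<le> a + \<bar>x\<bar>" "a + \<bar>x\<bar> \<le> 2" using x \<open>\<bar>x\<bar> < a\<close> a1 x1 by auto
  have "s \<le> s * (a + \<bar>x\<bar>)" using s sum by simp
  also have "\<dots> = (1 - sqrt (x\<^sup>2 + y\<^sup>2)) * (1 + sqrt (x\<^sup>2 + y\<^sup>2))"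
    unfolding prod[symmetric] by (simp add: algebra_simps flip: power2_eq_square)
  also have "\<dots> \<le> (1 - sqrt (x\<^sup>2 + y\<^sup>2)) * 2"
    using xy real_sqrt_le_1_iff[of "x\<^sup>2 + y\<^sup>2"] by (intro mult_left_mono) auto
  finally have sD: "s \<le> 2 * D" using D by simp
  have D0: "D > 0" using D \<delta> by simp
  \<comment> \<open>The power \<open>D ^ (2 * n)\<close> is shared equally: one half pays for
    \<open>u = s\<close>, the other for \<open>u = \<bar>y - b\<bar>\<close>. Each time
    \<open>\<delta> + u \<le> 3 * D\<close>, whence \<open>9 ^ n\<close>.\<close>
  have inv: "1 / D ^ n \<le> 3 ^ n / (\<delta> + u) ^ n" if "0 \<le> u" "u \<le> 2 * D" for u
  proof -
    have "(\<delta> + u) ^ n \<le> (3 * D) ^ n" using that D \<delta> by (intro power_mono) auto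
    moreover have "(\<delta> + u) ^ n > 0" using that \<delta> by simp
    ultimately show ?thesis using D0 by (simp add: divide_simps power_mult_distrib)
  qed
  have w: "(1 - (x\<^sup>2 + y\<^sup>2)) powr \<beta> \<le> max 1 (2 powr \<beta>) * s powr \<beta>"
  proof -
    have "(a + \<bar>x\<bar>) powr \<beta> \<le> max 1 (2 powr \<beta>)"
    proof (cases "\<beta> \<ge> 0")
      case True
      then have "(a + \<bar>x\<bar>) powr \<beta> \<le> 2 powr \<beta>" using sum by (intro powr_mono2) auto
      then show ?thesis unfolding le_max_iff_disj by (rule disjI2)
    next
      case False
      then have "(a + \<bar>x\<bar>) powr \<beta> \<le> 1 powr \<beta>" using sum by (intro powr_mono2') auto
      then show ?thesis unfolding le_max_iff_disj powr_one_eq_one by (rule disjI1)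
    qed
    then have "s powr \<beta> * (a + \<bar>x\<bar>) powr \<beta> \<le> s powr \<beta> * max 1 (2 powr \<beta>)"
      by (intro mult_left_mono) auto
    then show ?thesis unfolding prod using s sum by (simp add: powr_mult mult.commute)
  qed
  have "(1 - (x\<^sup>2 + y\<^sup>2)) powr \<beta> / D ^ (2 * n) = (1 - (x\<^sup>2 + y\<^sup>2)) powr \<beta> * ((1 / D ^ n) * (1 / D ^ n))"
    by (simp add: mult_2 power_add)
  also have "\<dots> \<le> (max 1 (2 powr \<beta>) * s powr \<beta>) * ((3 ^ n / (\<delta> + s) ^ n) * (3 ^ n / (\<delta> + \<bar>y - b\<bar>) ^ n))"
    using w inv[of s] inv[of "\<bar>y - b\<bar>"] s sD D D0 \<delta>
    by (intro mult_mono) (auto intro!: mult_nonneg_nonneg simp: le_max_iff_disj)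
  also have "\<dots> = max 1 (2 powr \<beta>) * 9 ^ n * (powr_kernel \<beta> n \<delta> s * (1 / (\<delta> + \<bar>y - b\<bar>) ^ n))"
  proof -
    have "(9::real) ^ n = 3 ^ n * 3 ^ n" by (simp flip: power_mult_distrib)
    then show ?thesis using s by (simp add: powr_kernel_def mult_ac)
  qed
  finally show ?thesis unfolding s_def a_def .
qed

text \<open>On the central square the modulus of the point is at most \<open>3/4\<close>, so
  \<open>D \<ge> 1/4\<close> whatever \<open>\<delta>\<close> is. The maximum covers both signs of
  \<open>\<beta>\<close>.\<close>

lemma kernel_bound_centre:
  fixes x y D \<beta> :: real
  assumes xy: "\<bar>x\<bar> \<le> 1/2" "\<bar>y\<bar> \<le> 1/2" and D: "1 - sqrt (x\<^sup>2 + y\<^sup>2) \<le> D"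
  shows "(1 - (x\<^sup>2 + y\<^sup>2)) powr \<beta> / D ^ (2 * n) \<le> max 1 ((1/2) powr \<beta>) * 16 ^ n"
proof -
  have "x\<^sup>2 \<le> (1/2)\<^sup>2" "y\<^sup>2 \<le> (1/2)\<^sup>2" 
    using power_mono[OF xy(1), of 2] power_mono[OF xy(2), of 2] by simp_all
  then have r: "0 \<le> x\<^sup>2 + y\<^sup>2" "x\<^sup>2 + y\<^sup>2 \<le> 1/2" by (auto simp: power2_eq_square)
  have "sqrt (x\<^sup>2 + y\<^sup>2) \<le> 3/4"
    by (rule real_le_lsqrt) (use r in \<open>auto simp: power2_eq_square\<close>)
  then have D4: "1/4 \<le> D" using D by simp
  have w: "(1 - (x\<^sup>2 + y\<^sup>2)) powr \<beta> \<le> max 1 ((1/2) powr \<beta>)"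
  proof (cases "\<beta> \<ge> 0")
    case True
    have "(1 - (x\<^sup>2 + y\<^sup>2)) powr \<beta> \<le> 1 powr \<beta>" by (rule powr_mono2) (use True r in linarith)+
    then show ?thesis unfolding le_max_iff_disj powr_one_eq_one by (rule disjI1)
  next
    case False
    have "(1 - (x\<^sup>2 + y\<^sup>2)) powr \<beta> \<le> (1/2) powr \<beta>" by (rule powr_mono2') (use False r in linarith)+
    then show ?thesis unfolding le_max_iff_disj by (rule disjI2)
  qed
  have "(1/4) ^ (2 * n) \<le> D ^ (2 * n)" using D4 by (intro power_mono) auto
  then have "(1 - (x\<^sup>2 + y\<^sup>2)) powr \<beta> / D ^ (2 * n) \<le> max 1 ((1/2) powr \<beta>) / (1/4) ^ (2 * n)"
    using w by (intro frac_le) auto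
  also have "(1/4::real) ^ (2 * n) = 1 / 16 ^ n" by (simp add: power_mult power_divide)
  finally show ?thesis by simp
qed

section \<open>Test functions\<close>

text \<open>An upper estimate of Forelli-Rudin type, uniform in \<open>\<alpha>\<close>. A point of
  the disc has a coordinate above \<open>1/2\<close> in absolute value or lies in the central
  square; in the first case the bound separates into factors with integrals of order
  \<open>\<delta> powr (\<beta> + 1 - n)\<close> and \<open>\<delta> powr (1 - n)\<close>.\<close>

lemma nn_integral_disc_kernel:
  assumes \<beta>: "\<beta> > -1" and n: "real n > \<beta> + 1" "n \<ge> 2"
  shows "\<exists>C>0. \<forall>\<alpha> \<delta>. norm \<alpha> = 1 \<longrightarrow> 0 < \<delta> \<longrightarrow> \<delta> < 1 \<longrightarrow>
    (\<integral>\<^sup>+z. ennreal (indicator (ball 0 1) z * ((1 - (norm z)\<^sup>2) powr \<beta> /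
        norm (1 - z * cnj (of_real (1 - \<delta>) * \<alpha>)) ^ (2 * n))) \<partial>lborel)
      \<le> ennreal (C * \<delta> powr (\<beta> + 2 - 2 * real n))"
proof -
  define c1 c2 where "c1 = max 1 (2 powr \<beta>) * 9 ^ n" and "c2 = max 1 ((1/2) powr \<beta>) * 16 ^ n"
  define I J where "I = 2 * (1 / (\<beta> + 1) + 1 / (real n - \<beta> - 1))" and "J = 2 * (1 + 1 / (real n - 1))"
  have pos: "c1 > 0" "c2 > 0" "I > 0" "J > 0"
    using assms by (auto simp: c1_def c2_def I_def J_def intro!: add_pos_pos mult_pos_pos max.strict_coboundedI1)
  define C where "C = 2 * (c1 * (I * J)) + c2 * pi"
  have "C > 0" using pos by (auto simp: C_def intro!: add_pos_pos mult_pos_pos)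
  moreover have "(\<integral>\<^sup>+z. ennreal (indicator (ball 0 1) z * ((1 - (norm z)\<^sup>2) powr \<beta> /
        norm (1 - z * cnj (of_real (1 - \<delta>) * \<alpha>)) ^ (2 * n))) \<partial>lborel)
      \<le> ennreal (C * \<delta> powr (\<beta> + 2 - 2 * real n))"
    if \<alpha>: "norm \<alpha> = 1" and \<delta>: "0 < \<delta>" "\<delta> < 1" for \<alpha> :: complex and \<delta> :: real
  proof -
    define k where "k = powr_kernel \<beta> n \<delta>"
    define l where "l b y = 1 / (\<delta> + \<bar>y - b\<bar>) ^ n" for b y :: real
    have [measurable]: "k \<in> borel_measurable borel" "l b \<in> borel_measurable borel" for b
      unfolding k_def l_def[abs_def] by measurable
    have nonneg: "k s \<ge> 0" "l b y \<ge> 0" for s b y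
      using \<delta> by (auto simp: k_def l_def powr_kernel_nonneg)
    define F where "F z = indicator (ball 0 1) z * ((1 - (norm z)\<^sup>2) powr \<beta> /
        norm (1 - z * cnj (of_real (1 - \<delta>) * \<alpha>)) ^ (2 * n))" for z
    define G where "G b x y = c1 * (k (sqrt (1 - y\<^sup>2) - \<bar>x\<bar>) * l b y)" for b x y :: real
    have G: "G b x y \<ge> 0" for b x y using nonneg pos by (simp add: G_def)
    have [measurable]: "(\<lambda>z. G b (Re z) (Im z)) \<in> borel_measurable borel"
      "(\<lambda>z. G b (Im z) (Re z)) \<in> borel_measurable borel" for b
      unfolding G_def by measurable
    have bound: "F z \<le> G (Im \<alpha>) (Re z) (Im z) + G (Re \<alpha>) (Im z) (Re z) + c2 * indicator (ball 0 1) z" for z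
    proof (cases "norm z < 1")
      case False
      then show ?thesis using G by (simp add: F_def)
    next
      case True
      define D where "D = norm (1 - z * cnj (of_real (1 - \<delta>) * \<alpha>))"
      have D: "\<delta> \<le> D" "1 - norm z \<le> D" "norm (z - \<alpha>) \<le> 2 * D"
        unfolding D_def using kernel_lower_bounds[OF True \<alpha> \<delta>] by auto
      have F: "F z = (1 - (norm z)\<^sup>2) powr \<beta> / D ^ (2 * n)" using True by (simp add: F_def D_def)
      have nz: "(norm z)\<^sup>2 = (Re z)\<^sup>2 + (Im z)\<^sup>2" by (rule cmod_power2)
      have nz1: "(Re z)\<^sup>2 + (Im z)\<^sup>2 < 1" using True unfolding nz[symmetric] by (simp add: power_less_one_iff)
      have nzs: "norm z = sqrt ((Re z)\<^sup>2 + (Im z)\<^sup>2)" by (rule cmod_def)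
      have abs: "\<bar>Re z - Re \<alpha>\<bar> \<le> 2 * D" "\<bar>Im z - Im \<alpha>\<bar> \<le> 2 * D"
        using D(3) abs_Re_le_cmod[of "z - \<alpha>"] abs_Im_le_cmod[of "z - \<alpha>"] by auto
      consider "\<bar>Re z\<bar> > 1/2" | "\<bar>Im z\<bar> > 1/2" | "\<bar>Re z\<bar> \<le> 1/2" "\<bar>Im z\<bar> \<le> 1/2" by linarith
      then show ?thesis
      proof cases
        case 1
        have "F z \<le> G (Im \<alpha>) (Re z) (Im z)"
          unfolding F G_def k_def l_def c1_def nz
          by (rule kernel_bound_sector[OF 1 nz1 \<delta> D(1) _ abs(2)]) (use D(2) nzs in simp)
        moreover have "0 \<le> c2 * indicator (ball 0 1) z" using pos by simp
        ultimately show ?thesis using G[of "Re \<alpha>" "Im z" "Re z"] by linarith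
      next
        case 2
        have "F z \<le> G (Re \<alpha>) (Im z) (Re z)"
          unfolding F G_def k_def l_def c1_def nz add.commute[of "(Re z)\<^sup>2"]
          by (rule kernel_bound_sector[OF 2 _ \<delta> D(1) _ abs(1)]) (use D(2) nzs nz1 in \<open>simp_all add: add.commute\<close>)
        moreover have "0 \<le> c2 * indicator (ball 0 1) z" using pos by simp
        ultimately show ?thesis using G[of "Im \<alpha>" "Re z" "Im z"] by linarith
      next
        case 3
        have "F z \<le> c2"
          unfolding F c2_def nz
          by (rule kernel_bound_centre[OF 3]) (use D(2) nzs in simp)
        then show ?thesis using G[of "Im \<alpha>" "Re z" "Im z"] G[of "Re \<alpha>" "Im z" "Re z"] True by simp
      qed
    qed
    define P where "P = \<delta> powr (\<beta> + 2 - 2 * real n)"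
    have GI: "(\<integral>\<^sup>+y. \<integral>\<^sup>+x. ennreal (G b x y) \<partial>lborel \<partial>lborel) \<le> ennreal (c1 * (I * J) * P)" for b
    proof -
      have "(\<integral>\<^sup>+y. \<integral>\<^sup>+x. ennreal (G b x y) \<partial>lborel \<partial>lborel) =
        (\<integral>\<^sup>+y. ennreal (c1 * l b y) * (\<integral>\<^sup>+x. ennreal (k (sqrt (1 - y\<^sup>2) - \<bar>x\<bar>)) \<partial>lborel) \<partial>lborel)"
        using nonneg pos by (subst nn_integral_cmult[symmetric]) (auto simp: G_def ennreal_mult'[symmetric] mult_ac)
      also have "\<dots> \<le> (\<integral>\<^sup>+y. ennreal (c1 * l b y) * ennreal (I * \<delta> powr (\<beta> + 1 - real n)) \<partial>lborel)"
        unfolding k_def I_def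
        by (intro nn_integral_mono mult_left_mono nn_integral_powr_kernel_abs) (use assms \<delta> in auto)
      also have "\<dots> = ennreal (c1 * (I * \<delta> powr (\<beta> + 1 - real n))) * (\<integral>\<^sup>+y. ennreal (l b y) \<partial>lborel)"
        using nonneg pos by (subst nn_integral_cmult[symmetric]) (auto simp: ennreal_mult'[symmetric] mult_ac)
      also have "\<dots> \<le> ennreal (c1 * (I * \<delta> powr (\<beta> + 1 - real n))) * ennreal (J * \<delta> powr (1 - real n))"
        unfolding l_def J_def by (intro mult_left_mono nn_integral_inverse_power_abs) (use n \<delta> in auto)
      also have "\<dots> = ennreal (c1 * (I * J) * (\<delta> powr (\<beta> + 1 - real n) * \<delta> powr (1 - real n)))"
        using pos by (subst ennreal_mult[symmetric]) (auto simp: mult_ac)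
      also have "\<delta> powr (\<beta> + 1 - real n) * \<delta> powr (1 - real n) = P"
        unfolding P_def powr_add[symmetric] by (simp add: algebra_simps)
      finally show ?thesis .
    qed
    \<comment> \<open>The exponent is negative by the hypotheses on \<open>n\<close>, so the bounded
      contribution of the central square is absorbed.\<close>
    have P1: "P \<ge> 1"
    proof -
      have "1 powr (\<beta> + 2 - 2 * real n) \<le> P"
        unfolding P_def by (rule powr_mono2') (use \<delta> assms in linarith)+
      then show ?thesis by simp
    qed
    have "(\<integral>\<^sup>+z. ennreal (F z) \<partial>lborel) \<le> (\<integral>\<^sup>+z. ennreal (G (Im \<alpha>) (Re z) (Im z)) +
      ennreal (G (Re \<alpha>) (Im z) (Re z)) + ennreal c2 * indicator (ball 0 1) z \<partial>lborel)"
    proof (rule nn_integral_mono)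
      fix z
      have "ennreal (F z) \<le> ennreal (G (Im \<alpha>) (Re z) (Im z) + G (Re \<alpha>) (Im z) (Re z) + c2 * indicator (ball 0 1) z)"
        by (rule ennreal_leI[OF bound])
      also have "\<dots> = ennreal (G (Im \<alpha>) (Re z) (Im z)) + ennreal (G (Re \<alpha>) (Im z) (Re z)) + ennreal c2 * indicator (ball 0 1) z"
        using G pos by (simp add: ennreal_plus ennreal_mult' ennreal_indicator)
      finally show "ennreal (F z) \<le> \<dots>" .
    qed
    also have "\<dots> = (\<integral>\<^sup>+z. ennreal (G (Im \<alpha>) (Re z) (Im z)) \<partial>lborel) +
      (\<integral>\<^sup>+z. ennreal (G (Re \<alpha>) (Im z) (Re z)) \<partial>lborel) + ennreal c2 * emeasure lborel (ball 0 1 :: complex set)"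
    proof -
      have add: "(\<integral>\<^sup>+z. f z + g z + h z \<partial>lborel) = (\<integral>\<^sup>+z. f z \<partial>lborel) + (\<integral>\<^sup>+z. g z \<partial>lborel) + (\<integral>\<^sup>+z. h z \<partial>lborel)"
        if "f \<in> borel_measurable lborel" "g \<in> borel_measurable lborel" "h \<in> borel_measurable lborel"
        for f g h :: "complex \<Rightarrow> ennreal"
        using that by (simp add: nn_integral_add)
      show ?thesis by (subst add) (measurable, simp_all add: nn_integral_cmult_indicator)
    qed
    also have "emeasure lborel (ball 0 1 :: complex set) = ennreal pi"
      by (simp add: emeasure_ball unit_ball_vol_2)
    also have "(\<integral>\<^sup>+z. ennreal (G (Im \<alpha>) (Re z) (Im z)) \<partial>lborel) \<le> ennreal (c1 * (I * J) * P)"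
      using GI[of "Im \<alpha>"] by (subst nn_integral_lborel_complex(1)) auto
    also have "(\<integral>\<^sup>+z. ennreal (G (Re \<alpha>) (Im z) (Re z)) \<partial>lborel) \<le> ennreal (c1 * (I * J) * P)"
      using GI[of "Re \<alpha>"] by (subst nn_integral_lborel_complex(2)) auto
    also have "ennreal c2 * ennreal pi \<le> ennreal (c2 * pi * P)"
      using pos P1 by (subst ennreal_mult'[symmetric]) (auto intro!: ennreal_leI)
    also have "ennreal (c1 * (I * J) * P) + ennreal (c1 * (I * J) * P) + ennreal (c2 * pi * P) = ennreal (C * P)"
      using pos P1 by (simp add: ennreal_plus[symmetric] C_def algebra_simps del: ennreal_plus)
    finally show ?thesis by (simp add: F_def P_def add_mono)
  qed
  ultimately show ?thesis by blast
qed

text \<open>The Szego kernel of the bidisc at \<open>w\<close>, raised to the power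
  \<open>n\<close>. The reproducing kernel of the weighted space has exponent
  \<open>\<beta> + 2\<close> instead; an integer exponent avoids branches of complex powers.\<close>

definition kernel_power :: "nat \<Rightarrow> complex \<times> complex \<Rightarrow> complex \<times> complex \<Rightarrow> complex" where
  "kernel_power n w z = 1 / ((1 - fst z * cnj (fst w)) * (1 - snd z * cnj (snd w))) ^ n"

lemma kernel_nonzero:
  fixes z w :: complex
  assumes "norm z \<le> 1" "norm w < 1"
  shows "1 - z * cnj w \<noteq> 0"
proof
  assume "1 - z * cnj w = 0"
  then have "norm z * norm w = 1" by (metis complex_mod_cnj eq_iff_diff_eq_0 norm_mult norm_one)
  moreover have "norm z * norm w \<le> 1 * norm w" using assms by (intro mult_right_mono) auto
  ultimately show False using assms by simp
qed

lemma holomorphic2_kernel_power: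
  assumes "norm (fst w) < 1" "norm (snd w) < 1"
  shows "holomorphic2_on (kernel_power n w) bidisc"
  unfolding holomorphic2_on_def
proof
  fix z assume "z \<in> bidisc"
  then have nz: "1 - fst z * cnj (fst w) \<noteq> 0" "1 - snd z * cnj (snd w) \<noteq> 0"
    using kernel_nonzero[of "fst z" "fst w"] kernel_nonzero[of "snd z" "snd w"] assms
    by (auto simp: bidisc_def)
  define u v where "u = 1 - fst z * cnj (fst w)" and "v = 1 - snd z * cnj (snd w)"
  have d: "((\<lambda>z. ((1 - fst z * cnj (fst w)) * (1 - snd z * cnj (snd w)))) has_derivative
     (\<lambda>h. (- (v * cnj (fst w))) * fst h + (- (u * cnj (snd w))) * snd h)) (at z within bidisc)"
    by (auto intro!: derivative_eq_intros simp: u_def v_def algebra_simps)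
  have "((\<lambda>x. 1 / x ^ n) has_field_derivative - (of_nat n * (u * v) ^ (n - 1)) / ((u * v) ^ n)\<^sup>2) (at (u * v))"
    using nz by (auto intro!: derivative_eq_intros simp: u_def v_def power2_eq_square)
  then have D: "((\<lambda>x. 1 / x ^ n) has_derivative (*) (- (of_nat n * (u * v) ^ (n - 1)) / ((u * v) ^ n)\<^sup>2))
     (at ((1 - fst z * cnj (fst w)) * (1 - snd z * cnj (snd w))))"
    by (simp add: has_field_derivative_def u_def v_def)
  have "\<exists>e. (kernel_power n w has_derivative (\<lambda>h. e * ((- (v * cnj (fst w))) * fst h + (- (u * cnj (snd w))) * snd h))) (at z within bidisc)"
    using has_derivative_compose[OF d D] unfolding kernel_power_def[abs_def] by blast
  then obtain e where "(kernel_power n w has_derivative (\<lambda>h. e * ((- (v * cnj (fst w))) * fst h + (- (u * cnj (snd w))) * snd h))) (at z within bidisc)" ..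
  then show "\<exists>a b. (kernel_power n w has_derivative (\<lambda>h. a * fst h + b * snd h)) (at z within bidisc)"
    by (intro exI[of _ "e * (- (v * cnj (fst w)))"] exI[of _ "e * (- (u * cnj (snd w)))"]) (simp add: algebra_simps)
qed

text \<open>Kernel and weight are products of one-variable functions, so Tonelli's theorem gives the
  product of two disc integrals, divided by the normalisation \<open>pi\<^sup>2\<close>.\<close>

lemma kernel_power_bergman:
  assumes \<beta>: "\<beta> > -1" and n: "real n > \<beta> + 1" "n \<ge> 2"
  shows "\<exists>C>0. \<forall>\<alpha>1 \<alpha>2 \<delta>. norm \<alpha>1 = 1 \<longrightarrow> norm \<alpha>2 = 1 \<longrightarrow> 0 < \<delta> \<longrightarrow> \<delta> < 1 \<longrightarrow>
    kernel_power n (of_real (1 - \<delta>) * \<alpha>1, of_real (1 - \<delta>) * \<alpha>2) \<in> bergman_space \<beta> \<and>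
    (bergman_norm \<beta> (kernel_power n (of_real (1 - \<delta>) * \<alpha>1, of_real (1 - \<delta>) * \<alpha>2)))\<^sup>2
      \<le> C * \<delta> powr (2 * \<beta> + 4 - 4 * real n)"
proof -
  obtain C where C: "C > 0" and bound: "\<And>\<alpha> \<delta>. norm \<alpha> = 1 \<Longrightarrow> 0 < \<delta> \<Longrightarrow> \<delta> < 1 \<Longrightarrow>
    (\<integral>\<^sup>+z. ennreal (indicator (ball 0 1) z * ((1 - (norm z)\<^sup>2) powr \<beta> /
        norm (1 - z * cnj (of_real (1 - \<delta>) * \<alpha>)) ^ (2 * n))) \<partial>lborel)
      \<le> ennreal (C * \<delta> powr (\<beta> + 2 - 2 * real n))"
    using nn_integral_disc_kernel[OF assms] by blast
  have "kernel_power n w \<in> bergman_space \<beta> \<and>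
    (bergman_norm \<beta> (kernel_power n w))\<^sup>2 \<le> (C\<^sup>2 / pi\<^sup>2) * \<delta> powr (2 * \<beta> + 4 - 4 * real n)"
    if \<alpha>: "norm \<alpha>1 = 1" "norm \<alpha>2 = 1" and \<delta>: "0 < \<delta>" "\<delta> < 1"
      and w_def: "w = (of_real (1 - \<delta>) * \<alpha>1, of_real (1 - \<delta>) * \<alpha>2)"
    for \<alpha>1 \<alpha>2 :: complex and \<delta> :: real and w
  proof -
    define F where "F \<alpha> z = indicator (ball 0 1) z * ((1 - (norm z)\<^sup>2) powr \<beta> /
        norm (1 - z * cnj (of_real (1 - \<delta>) * \<alpha>)) ^ (2 * n))" for \<alpha> z
    have [measurable]: "F \<alpha> \<in> borel_measurable borel" for \<alpha>
    proof -
      have [measurable]: "(\<lambda>z. norm (1 - z * cnj (of_real (1 - \<delta>) * \<alpha>))) \<in> borel_measurable borel"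
        "(\<lambda>z::complex. norm z) \<in> borel_measurable borel"
        by (intro borel_measurable_continuous_onI continuous_intros)+
      have [measurable]: "(indicator (ball 0 1) :: complex \<Rightarrow> real) \<in> borel_measurable borel"
        by (intro borel_measurable_indicator) simp
      show ?thesis unfolding F_def[abs_def]
        by (intro borel_measurable_times borel_measurable_divide powr_real_measurable borel_measurable_power
            borel_measurable_diff) measurable
    qed
    have F0: "F \<alpha> z \<ge> 0" for \<alpha> z by (simp add: F_def)
    define f where "f z = indicator bidisc z * ((norm (kernel_power n w z))\<^sup>2 * bergman_weight \<beta> z)" for z
    have f: "f z = F \<alpha>1 (fst z) * F \<alpha>2 (snd z) / pi\<^sup>2" for z
      by (auto simp: f_def F_def bidisc_def kernel_power_def bergman_weight_def w_def indicator_def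
          norm_divide norm_power norm_mult power_mult_distrib power_divide mem_Times_iff simp flip: power_mult)
         (auto simp: mult_ac power_mult)
    have fm [measurable]: "f \<in> borel_measurable lborel"
      unfolding f[abs_def] lborel_prod[symmetric] by measurable
    have f0: "f z \<ge> 0" for z by (simp add: f F0)
    have "(\<integral>\<^sup>+z. ennreal (f z) \<partial>lborel) =
      (\<integral>\<^sup>+z. ennreal (1 / pi\<^sup>2) * (ennreal (F \<alpha>1 (fst z)) * ennreal (F \<alpha>2 (snd z))) \<partial>(lborel \<Otimes>\<^sub>M lborel))"
      unfolding lborel_prod by (intro nn_integral_cong) (simp add: f F0 ennreal_mult'[symmetric])
    also have "\<dots> = ennreal (1 / pi\<^sup>2) * (\<integral>\<^sup>+z. ennreal (F \<alpha>1 (fst z)) * ennreal (F \<alpha>2 (snd z)) \<partial>(lborel \<Otimes>\<^sub>M lborel))"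
      by (subst nn_integral_cmult) auto
    also have "(\<integral>\<^sup>+z. ennreal (F \<alpha>1 (fst z)) * ennreal (F \<alpha>2 (snd z)) \<partial>(lborel \<Otimes>\<^sub>M lborel)) =
      (\<integral>\<^sup>+x. \<integral>\<^sup>+y. ennreal (F \<alpha>1 x) * ennreal (F \<alpha>2 y) \<partial>lborel \<partial>lborel)"
      by (subst lborel.nn_integral_fst[symmetric]) auto
    also have "\<dots> = (\<integral>\<^sup>+x. ennreal (F \<alpha>1 x) \<partial>lborel) * (\<integral>\<^sup>+y. ennreal (F \<alpha>2 y) \<partial>lborel)"
      by (simp add: nn_integral_cmult nn_integral_multc)
    also have "\<dots> \<le> ennreal (C * \<delta> powr (\<beta> + 2 - 2 * real n)) * ennreal (C * \<delta> powr (\<beta> + 2 - 2 * real n))"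
      unfolding F_def using bound \<alpha> \<delta> by (intro mult_mono) auto
    also have "\<dots> = ennreal (C\<^sup>2 * \<delta> powr (2 * \<beta> + 4 - 4 * real n))"
    proof -
      have "\<delta> powr (\<beta> + 2 - 2 * real n) * \<delta> powr (\<beta> + 2 - 2 * real n) = \<delta> powr (2 * \<beta> + 4 - 4 * real n)"
        unfolding powr_add[symmetric] by (simp add: algebra_simps)
      then show ?thesis using C
        by (subst ennreal_mult[symmetric]) (auto simp: power2_eq_square mult_ac)
    qed
    finally have int: "(\<integral>\<^sup>+z. ennreal (f z) \<partial>lborel) \<le> ennreal ((C\<^sup>2 / pi\<^sup>2) * \<delta> powr (2 * \<beta> + 4 - 4 * real n))"
      by (simp add: ennreal_mult'[symmetric] mult_left_mono)
    then have "integrable lborel f"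
      by (intro integrableI_nonneg) (auto simp: f0 intro: le_less_trans)
    moreover have "integral\<^sup>L lborel f \<le> (C\<^sup>2 / pi\<^sup>2) * \<delta> powr (2 * \<beta> + 4 - 4 * real n)"
      using int by (intro integral_real_bounded) auto
    moreover have "0 \<le> integral\<^sup>L lborel f" by (simp add: f0)
    moreover have "norm (fst w) < 1" "norm (snd w) < 1"
      using \<delta> \<alpha> by (simp_all add: w_def norm_mult del: of_real_diff)
    ultimately show ?thesis
      using holomorphic2_kernel_power[of w n]
      by (simp add: bergman_space_def bergman_norm_def set_integrable_def set_lebesgue_integral_def f_def[abs_def])
  qed
  moreover have "C\<^sup>2 / pi\<^sup>2 > 0" using C by simp
  ultimately show ?thesis by blast
qed

section \<open>Lower bounds near a curve in the bitorus\<close>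

lemma norm_cis_diff: "norm (cis a - cis b) = 2 * \<bar>sin ((a - b) / 2)\<bar>"
proof -
  have "cis a - cis b = cis b * (cis (a - b) - 1)" by (simp add: cis_mult right_diff_distrib)
  then have "norm (cis a - cis b) = norm (cis (a - b) - 1)" by (simp only: norm_mult norm_cis mult_1)
  then show ?thesis by (simp only: cis_conv_exp dist_exp_i_1)
qed

lemma sin_ge_half: assumes "0 \<le> x" "x \<le> 1" shows "sin x \<ge> x / (2::real)"
proof -
  have "{..<3::nat} = {0, 1, 2}" by auto
  then have "(\<Sum>m<3. sin_coeff m * x ^ m) = x" by (simp add: sin_coeff_def)
  moreover have "inverse (fact 3 :: real) = 1 / 6" by (simp add: fact_numeral)
  ultimately have "\<bar>sin x - x\<bar> \<le> 1 / 6 * x ^ 3"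
    using Maclaurin_sin_bound[of x 3] assms by (simp only: abs_of_nonneg)
  moreover have "x ^ 3 \<le> x"
    using power_decreasing[of 1 3 x] assms by simp
  ultimately show ?thesis using assms by linarith
qed

lemma norm_cis_diff_bounds:
  assumes "\<bar>a - b\<bar> \<le> 1"
  shows "\<bar>a - b\<bar> / 2 \<le> norm (cis a - cis b)" "norm (cis a - cis b) \<le> \<bar>a - b\<bar>"
proof -
  have half: "\<bar>a - b\<bar> / 2 / 2 \<le> sin (\<bar>a - b\<bar> / 2)"
    by (rule sin_ge_half) (use assms in auto)
  have "sin ((a - b) / 2) = sin (\<bar>a - b\<bar> / 2) \<or> sin ((a - b) / 2) = - sin (\<bar>a - b\<bar> / 2)"
  proof (cases "a \<ge> b")
    case False
    then have "(a - b) / 2 = - (\<bar>a - b\<bar> / 2)" by (simp add: field_simps)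
    then show ?thesis by (simp only: sin_minus simp_thms)
  qed simp
  moreover have "sin (\<bar>a - b\<bar> / 2) \<ge> 0"
    by (rule order_trans[OF _ half]) simp
  ultimately have "\<bar>sin ((a - b) / 2)\<bar> = sin (\<bar>a - b\<bar> / 2)"
    by (elim disjE) (simp_all only: abs_minus_cancel abs_of_nonneg)
  then show "\<bar>a - b\<bar> / 2 \<le> norm (cis a - cis b)"
    using half by (simp add: norm_cis_diff)
  show "norm (cis a - cis b) \<le> \<bar>a - b\<bar>"
    using abs_sin_x_le_abs_x[of "(a - b) / 2"] by (simp add: norm_cis_diff)
qed

text \<open>The minimum serves both signs of \<open>\<beta>\<close>: the power is smallest at the
  lower end of the interval for \<open>\<beta> \<ge> 0\<close> and at the upper end
  otherwise.\<close>

lemma powr_near: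
  fixes r x \<beta> :: real
  assumes "r > 0" "7 / 8 * r \<le> x" "x \<le> 9 / 4 * r"
  shows "min ((7/8) powr \<beta>) ((9/4) powr \<beta>) * r powr \<beta> \<le> x powr \<beta>"
proof (cases "\<beta> \<ge> 0")
  case True
  have "(7/8) powr \<beta> * r powr \<beta> \<le> x powr \<beta>" unfolding powr_mult[symmetric] by (rule powr_mono2) (use assms True in auto)
  moreover have "min ((7/8) powr \<beta>) ((9/4) powr \<beta>) * r powr \<beta> \<le> (7/8) powr \<beta> * r powr \<beta>"
    by (rule mult_right_mono) auto
  ultimately show ?thesis by (rule order_trans[rotated])
next
  case False
  have "(9/4) powr \<beta> * r powr \<beta> \<le> x powr \<beta>" unfolding powr_mult[symmetric] by (rule powr_mono2') (use assms False in auto)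
  moreover have "min ((7/8) powr \<beta>) ((9/4) powr \<beta>) * r powr \<beta> \<le> (9/4) powr \<beta> * r powr \<beta>"
    by (rule mult_right_mono) auto
  ultimately show ?thesis by (rule order_trans[rotated])
qed

text \<open>The distance from \<open>z\<close> to the circle is between \<open>7/8 * r\<close> and
  \<open>9/8 * r\<close>; passing from \<open>1 - norm z\<close> to
  \<open>1 - (norm z)\<^sup>2\<close> at most doubles it, which gives \<open>9/4\<close>.\<close>

lemma weight_near_circle:
  fixes z c :: complex
  assumes r: "0 < r" "r \<le> 1/2" and c: "norm c = 1" and z: "norm (z - of_real (1 - r) * c) < r / 8"
  shows "norm z < 1"
    "min ((7/8) powr \<beta>) ((9/4) powr \<beta>) * r powr \<beta> \<le> (1 - (norm z)\<^sup>2) powr \<beta>"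
proof -
  have nc: "norm (of_real (1 - r) * c) = 1 - r" using r c by (simp add: norm_mult del: of_real_diff)
  have "\<bar>norm z - (1 - r)\<bar> < r / 8"
    using norm_triangle_ineq3[of z "of_real (1 - r) * c"] z nc by simp
  then have *: "7/8 * r < 1 - norm z" "1 - norm z < 9/8 * r" by (auto simp: abs_if split: if_splits)
  then show lt: "norm z < 1" using r by simp
  have "(norm z)\<^sup>2 \<le> norm z" using lt by (simp add: power2_eq_square mult_left_le)
  then have "7/8 * r \<le> 1 - (norm z)\<^sup>2" using *(1) by linarith
  moreover have "1 - (norm z)\<^sup>2 \<le> 9/4 * r"
  proof -
    have "1 - (norm z)\<^sup>2 \<le> 2 * (1 - norm z)"
      using zero_le_power2[of "1 - norm z"] by (simp add: power2_diff)
    also have "\<dots> \<le> 9/4 * r" using *(2) by simp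
    finally show ?thesis .
  qed
  ultimately show "min ((7/8) powr \<beta>) ((9/4) powr \<beta>) * r powr \<beta> \<le> (1 - (norm z)\<^sup>2) powr \<beta>"
    by (rule powr_near[OF r(1)])
qed

text \<open>About \<open>T / r\<close> of the polydiscs centred at \<open>(1 - r) (\<zeta>, g(\<zeta>))\<close> are disjoint.\<close>

lemma bergman_norm_lower_bound:
  fixes \<beta> :: real
  shows "\<exists>c>0. \<forall>F g \<omega>1 r T L. F \<in> bergman_space \<beta> \<longrightarrow> g ` torus \<subseteq> torus \<longrightarrow> \<omega>1 \<in> torus \<longrightarrow>
    0 < r \<longrightarrow> r \<le> T \<longrightarrow> T \<le> 1/2 \<longrightarrow> 0 \<le> L \<longrightarrow>
    (\<forall>\<theta> z1 z2. T \<le> \<theta> \<longrightarrow> \<theta> \<le> 2 * T \<longrightarrow> norm (z1 - of_real (1 - r) * (\<omega>1 * cis \<theta>)) < r / 8 \<longrightarrow>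
      norm (z2 - of_real (1 - r) * g (\<omega>1 * cis \<theta>)) < r / 8 \<longrightarrow> L \<le> (norm (F (z1, z2)))\<^sup>2) \<longrightarrow>
    c * L * T * r powr (2 * \<beta> + 3) \<le> (bergman_norm \<beta> F)\<^sup>2"
proof -
  define m where "m = min ((7/8) powr \<beta>) ((9/4) powr \<beta>)"
  have m: "m > 0" by (simp add: m_def)
  have "m\<^sup>2 / 8192 * L * T * r powr (2 * \<beta> + 3) \<le> (bergman_norm \<beta> F)\<^sup>2"
    if F: "F \<in> bergman_space \<beta>" and g: "g ` torus \<subseteq> torus" and \<omega>1: "\<omega>1 \<in> torus"
      and r: "0 < r" "r \<le> T" "T \<le> 1/2" and L: "0 \<le> L"
      and lower: "\<And>\<theta> z1 z2. T \<le> \<theta> \<Longrightarrow> \<theta> \<le> 2 * T \<Longrightarrow> norm (z1 - of_real (1 - r) * (\<omega>1 * cis \<theta>)) < r / 8 \<Longrightarrow>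
      norm (z2 - of_real (1 - r) * g (\<omega>1 * cis \<theta>)) < r / 8 \<Longrightarrow> L \<le> (norm (F (z1, z2)))\<^sup>2"
    for F g \<omega>1 r T L
  proof -
    \<comment> \<open>Since \<open>r \<le> T\<close>, this is at least \<open>1\<close>, so rounding
      down loses at most half of \<open>T / r\<close>.\<close>
    define N where "N = nat \<lfloor>T / r\<rfloor>"
    have Nr: "real N * r \<le> T" "T / (2 * r) \<le> real N"
    proof -
      have "1 \<le> T / r" using r by simp
      then have N: "real N \<le> T / r" "T / r < real N + 1" "1 \<le> real N"
      proof -
        have "\<lfloor>T / r\<rfloor> \<ge> 1" using \<open>1 \<le> T / r\<close> by (simp add: le_floor_iff)
        then have "real N = of_int \<lfloor>T / r\<rfloor>" "1 \<le> real_of_int \<lfloor>T / r\<rfloor>" by (simp_all add: N_def)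
        then show "real N \<le> T / r" "T / r < real N + 1" "1 \<le> real N" by linarith+
      qed
      then show "real N * r \<le> T" using r by (simp add: pos_le_divide_eq)
      have "T / r \<le> 2 * real N" using N by linarith
      then have "T \<le> 2 * real N * r" using r by (simp only: pos_divide_le_eq)
      then have "T \<le> real N * (2 * r)" by (simp only: mult_ac)
      then show "T / (2 * r) \<le> real N" using r by (subst pos_divide_le_eq) simp_all
    qed
    define \<theta> where "\<theta> k = T + real k * r" for k
    have \<theta>: "T \<le> \<theta> k" "\<theta> k \<le> 2 * T" if "k < N" for k
    proof -
      have "real k * r \<le> real N * r" using that r by (intro mult_right_mono) auto
      from order_trans[OF this Nr(1)] show "T \<le> \<theta> k" "\<theta> k \<le> 2 * T" using r by (simp_all add: \<theta>_def)
    qed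
    define a b where "a k = \<omega>1 * cis (\<theta> k)" and "b k = g (a k)" for k
    have na: "norm (a k) = 1" for k using \<omega>1 by (simp add: a_def norm_mult)
    have nb: "norm (b k) = 1" for k using g na[of k] by (auto simp: b_def image_subset_iff)
    define P where "P k = ball (of_real (1 - r) * a k) (r / 8) \<times> ball (of_real (1 - r) * b k) (r / 8)" for k
    have P: "norm (fst z - of_real (1 - r) * a k) < r / 8" "norm (snd z - of_real (1 - r) * b k) < r / 8"
      if "z \<in> P k" for z k
      using that by (auto simp: P_def dist_norm norm_minus_commute)
    define h where "h z = indicator bidisc z * ((norm (F z))\<^sup>2 * bergman_weight \<beta> z)" for z
    define e where "e = L * ((m * r powr \<beta>) * (m * r powr \<beta>) / pi\<^sup>2)"
    have e: "e \<ge> 0" using L by (simp add: e_def)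
    \<comment> \<open>The first coordinates already separate the polydiscs: the angles differ by at
      least \<open>r\<close>, the points on the circle by at least \<open>r / 2\<close>, and the
      centres, scaled by \<open>1 - r \<ge> 1/2\<close>, by at least \<open>r / 4\<close>, twice the
      radius \<open>r / 8\<close>.\<close>
    have disj: "P k \<inter> P l = {}" if "k < N" "l < N" "k \<noteq> l" for k l
    proof (rule ccontr)
      assume "P k \<inter> P l \<noteq> {}"
      then obtain z where "z \<in> P k" "z \<in> P l" by blast
      note z = P(1)[OF this(1)] P(1)[OF this(2)]
      have d: "of_real (1 - r) * (a k - a l) = (fst z - of_real (1 - r) * a l) - (fst z - of_real (1 - r) * a k)"
        by (simp add: algebra_simps)
      have "norm (of_real (1 - r) * (a k - a l)) < r / 8 + r / 8"
        unfolding d by (rule le_less_trans[OF norm_triangle_ineq4]) (use z in linarith)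
      moreover have "norm (of_real (1 - r) * (a k - a l)) = (1 - r) * norm (cis (\<theta> k) - cis (\<theta> l))"
        using r \<omega>1 by (simp add: norm_mult a_def right_diff_distrib[symmetric] del: of_real_diff)
      moreover have far: "norm (cis (\<theta> k) - cis (\<theta> l)) \<ge> r / 2"
      proof -
        have "1 \<le> \<bar>real k - real l\<bar>" using that(3) by linarith
        then have "1 * r \<le> \<bar>real k - real l\<bar> * r" using r by (intro mult_right_mono) auto
        also have "\<dots> = \<bar>(real k - real l) * r\<bar>" using r by (simp add: abs_mult)
        also have "(real k - real l) * r = \<theta> k - \<theta> l" by (simp add: \<theta>_def algebra_simps)
        finally have "r / 2 \<le> \<bar>\<theta> k - \<theta> l\<bar> / 2" by simp
        also have "\<bar>\<theta> k - \<theta> l\<bar> \<le> 1" using \<theta>[OF that(1)] \<theta>[OF that(2)] r by linarith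
        then have "\<bar>\<theta> k - \<theta> l\<bar> / 2 \<le> norm (cis (\<theta> k) - cis (\<theta> l))"
          by (rule norm_cis_diff_bounds(1))
        finally show ?thesis .
      qed
      moreover have "1/2 * (r / 2) \<le> (1 - r) * norm (cis (\<theta> k) - cis (\<theta> l))"
        using r far by (intro mult_mono) auto
      ultimately show False by simp
    qed
    have Pm: "P k \<in> sets lborel" for k by (simp add: P_def borel_open open_Times)
    have Pmeas: "measure lborel (P k) = (pi * (r / 8)\<^sup>2)\<^sup>2" and Pfin: "emeasure lborel (P k) < \<infinity>" for k
    proof -
      have "emeasure lborel (P k) = emeasure (lborel \<Otimes>\<^sub>M lborel) (P k)" by (simp only: lborel_prod)
      also have "\<dots> = ennreal (pi * (r / 8)\<^sup>2) * ennreal (pi * (r / 8)\<^sup>2)"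
        unfolding P_def using r by (subst lborel.emeasure_pair_measure_Times) (auto simp: emeasure_ball unit_ball_vol_2)
      also have "\<dots> = ennreal ((pi * (r / 8)\<^sup>2)\<^sup>2)" by (simp add: ennreal_mult'[symmetric] power2_eq_square)
      finally have *: "emeasure lborel (P k) = ennreal ((pi * (r / 8)\<^sup>2)\<^sup>2)" .
      then show "measure lborel (P k) = (pi * (r / 8)\<^sup>2)\<^sup>2" by (simp add: measure_def)
      show "emeasure lborel (P k) < \<infinity>" unfolding * by simp
    qed
    have pointwise: "e * (\<Sum>k<N. indicator (P k) z) \<le> h z" for z
    proof (cases "z \<in> (\<Union>k<N. P k)")
      case True
      then obtain k where k: "k < N" "z \<in> P k" by blast
      have "(\<Sum>k<N. indicator (P k) z :: real) = indicator (\<Union>k<N. P k) z"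
        by (rule indicator_UN_disjoint[symmetric]) (use disj in \<open>auto simp: disjoint_family_on_def\<close>)
      then have sum1: "(\<Sum>k<N. indicator (P k) z :: real) = 1" using True by simp
      note w1 = weight_near_circle[OF r(1) _ na[of k] P(1)[OF k(2)]]
      note w2 = weight_near_circle[OF r(1) _ nb[of k] P(2)[OF k(2)]]
      have "e \<le> (norm (F z))\<^sup>2 * bergman_weight \<beta> z"
        unfolding e_def bergman_weight_def
      proof (intro mult_mono divide_right_mono)
        show "L \<le> (norm (F z))\<^sup>2"
          using lower[OF \<theta>[OF k(1)], of "fst z" "snd z"] P[OF k(2)] by (simp add: a_def b_def)
      qed (use m r w1(2)[of \<beta>] w2(2)[of \<beta>] in \<open>auto simp: m_def\<close>)
      moreover have "z \<in> bidisc" using w1(1) w2(1) r by (auto simp: bidisc_def mem_Times_iff)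
      ultimately show ?thesis by (simp add: sum1 h_def)
    next
      case False
      then have "(\<Sum>k<N. indicator (P k) z :: real) = 0" by (intro sum.neutral) auto
      then show ?thesis by (simp add: h_def bergman_weight_def)
    qed
    have int: "integrable lborel h" and norm: "(bergman_norm \<beta> F)\<^sup>2 = integral\<^sup>L lborel h"
    proof -
      show "integrable lborel h"
        using F by (simp add: bergman_space_def set_integrable_def h_def[abs_def])
      have "0 \<le> integral\<^sup>L lborel h" by (rule integral_nonneg_AE) (auto simp: h_def bergman_weight_def)
      then show "(bergman_norm \<beta> F)\<^sup>2 = integral\<^sup>L lborel h"
        by (simp add: bergman_norm_def set_lebesgue_integral_def h_def[abs_def])
    qed
    have "real N * (pi * (r / 8)\<^sup>2)\<^sup>2 * e = (\<integral>z. e * (\<Sum>k<N. indicator (P k) z) \<partial>lborel)"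
      using Pm Pfin by (simp add: Pmeas)
    also have "\<dots> \<le> integral\<^sup>L lborel h"
      by (rule integral_mono) (use Pm Pfin int pointwise in auto)
    finally have main: "real N * (pi * (r / 8)\<^sup>2)\<^sup>2 * e \<le> (bergman_norm \<beta> F)\<^sup>2" by (simp add: norm)
    have "m\<^sup>2 / 8192 * L * T * r powr (2 * \<beta> + 3) = T / (2 * r) * (pi * (r / 8)\<^sup>2)\<^sup>2 * e"
    proof -
      define A where "A = r powr \<beta>"
      have "r powr (2 * \<beta> + 3) * r powr 1 = A * A * r powr 4"
        unfolding A_def powr_add[symmetric] by (rule arg_cong[of _ _ "(powr) r"]) simp
      moreover have "r powr 4 = r ^ 4" "r powr 1 = r" using r by simp_all
      ultimately have "r powr (2 * \<beta> + 3) = A * A * r ^ 4 / r"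
        using r by (simp add: eq_divide_eq)
      \<comment> \<open>Here \<open>8192 = 2 * 8 ^ 4\<close>: the \<open>2\<close> comes from the
        lower bound for \<open>N\<close>, the rest from the polydisc volume, whose
        \<open>pi\<^sup>2\<close> cancels the normalisation.\<close>
      moreover have "T / (2 * r) * (pi * (r / 8)\<^sup>2)\<^sup>2 * (L * ((m * A) * (m * A) / pi\<^sup>2)) =
        m\<^sup>2 / 8192 * L * T * (A * A * r ^ 4 / r)"
        using r by (simp add: power2_eq_square power4_eq_xxxx)
      ultimately show ?thesis by (simp only: e_def A_def)
    qed
    also have "\<dots> \<le> real N * (pi * (r / 8)\<^sup>2)\<^sup>2 * e"
      using Nr(2) e by (intro mult_right_mono) auto
    finally show ?thesis using main by linarith
  qed
  moreover have "m\<^sup>2 / 8192 > 0" using m by simp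
  ultimately show ?thesis by blast
qed

section \<open>Unboundedness\<close>

lemma tendsto_powr_0_at_right:
  assumes "x > 0"
  shows "((\<lambda>T. c * T powr x) \<longlongrightarrow> 0) (at_right (0::real))"
proof -
  have "((\<lambda>T. T powr x) \<longlongrightarrow> 0 powr x) (at_right (0::real))"
    by (rule tendsto_powr2) (use assms in \<open>auto simp: eventually_at_filter\<close>)
  from tendsto_mult_left[OF this, of c] show ?thesis by simp
qed

text \<open>Each denominator factor equals
  \<open>(1 - \<delta>) * (cnj \<alpha> * (\<alpha> - z)) + \<delta>\<close>, of modulus at most
  \<open>2 * \<delta>\<close>; two factors, the power \<open>n\<close> and the square make
  \<open>4 * n\<close> of them. Arguments on the unit circle are allowed, the kernel being centred
  at an interior point.\<close>

lemma kernel_power_lower_bound: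
  assumes \<alpha>: "norm \<alpha>1 = 1" "norm \<alpha>2 = 1" and \<delta>: "0 < \<delta>" "\<delta> < 1"
    and u: "norm u \<le> 1" "norm (\<alpha>1 - u) \<le> \<delta>" and v: "norm v \<le> 1" "norm (\<alpha>2 - v) \<le> \<delta>"
  shows "(1 / 2) ^ (4 * n) * \<delta> powr (- 4 * real n) \<le>
    (norm (kernel_power n (of_real (1 - \<delta>) * \<alpha>1, of_real (1 - \<delta>) * \<alpha>2) (u, v)))\<^sup>2"
proof -
  define D where "D \<alpha> z = norm (1 - z * cnj (of_real (1 - \<delta>) * \<alpha>))" for \<alpha> z
  have D: "0 < D \<alpha> z" "D \<alpha> z \<le> 2 * \<delta>" if "norm \<alpha> = 1" "norm z \<le> 1" "norm (\<alpha> - z) \<le> \<delta>" for \<alpha> z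
  proof -
    have "norm (of_real (1 - \<delta>) * \<alpha>) < 1" using that \<delta> by (simp add: norm_mult del: of_real_diff)
    then show "0 < D \<alpha> z" unfolding D_def zero_less_norm_iff by (rule kernel_nonzero[OF that(2)])
    have "cnj \<alpha> * \<alpha> = 1" using that by (metis complex_norm_square mult.commute of_real_1 power_one)
    then have "1 - z * cnj (of_real (1 - \<delta>) * \<alpha>) = of_real (1 - \<delta>) * (cnj \<alpha> * (\<alpha> - z)) + of_real \<delta>"
      by (simp add: algebra_simps)
    then have "D \<alpha> z \<le> norm (of_real (1 - \<delta>) * (cnj \<alpha> * (\<alpha> - z))) + norm (complex_of_real \<delta>)"
      unfolding D_def by (simp only: norm_triangle_ineq)
    also have "\<dots> = (1 - \<delta>) * norm (\<alpha> - z) + \<delta>"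
      using \<delta> that by (simp add: norm_mult del: of_real_diff)
    also have "(1 - \<delta>) * norm (\<alpha> - z) \<le> 1 * \<delta>" using that \<delta> by (intro mult_mono) auto
    finally show "D \<alpha> z \<le> 2 * \<delta>" by simp
  qed
  have pos: "0 < D \<alpha>1 u * D \<alpha>2 v" using D \<alpha> u v by simp
  have "D \<alpha>1 u * D \<alpha>2 v \<le> (2 * \<delta>) * (2 * \<delta>)"
    using D[OF \<alpha>(1) u] D[OF \<alpha>(2) v] by (intro mult_mono) auto
  then have "(D \<alpha>1 u * D \<alpha>2 v) ^ (2 * n) \<le> ((2 * \<delta>) * (2 * \<delta>)) ^ (2 * n)"
    using pos by (intro power_mono) auto
  also have "\<dots> = (2 * \<delta>) ^ (4 * n)"
  proof -
    have "4 * n = 2 * (2 * n)" by simp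
    then show ?thesis by (simp only: power_mult[of _ 2] power2_eq_square)
  qed
  finally have "1 / (2 * \<delta>) ^ (4 * n) \<le> 1 / (D \<alpha>1 u * D \<alpha>2 v) ^ (2 * n)"
    by (intro frac_le zero_less_power[OF pos]) simp_all
  also have "1 / (D \<alpha>1 u * D \<alpha>2 v) ^ (2 * n) =
    (norm (kernel_power n (of_real (1 - \<delta>) * \<alpha>1, of_real (1 - \<delta>) * \<alpha>2) (u, v)))\<^sup>2"
    unfolding kernel_power_def fst_conv snd_conv norm_divide norm_power norm_mult norm_one D_def power_divide
    by (simp add: power_mult[symmetric] mult.commute)
  also have "1 / (2 * \<delta>) ^ (4 * n) = (1 / 2) ^ (4 * n) * (1 / \<delta> ^ (4 * n))"
    by (simp add: power_mult_distrib power_divide)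
  also have "1 / \<delta> ^ (4 * n) = \<delta> powr (- 4 * real n)"
    using \<delta> powr_realpow[of \<delta> "4 * n"] by (simp add: powr_minus divide_inverse)
  finally show ?thesis .
qed

text \<open>Separates the operator theory from rational inner functions: \<open>near\<close> records
  how \<open>\<Phi>\<close> concentrates, with polydisc radius \<open>A * T powr M\<close> and image
  size \<open>B * T powr (M - K)\<close>. That \<open>f \<circ> \<Phi>\<close> lies in the space is
  part of the boundedness being refuted.\<close>

lemma not_bounded_if_concentrated:
  fixes \<beta> K M A B :: real and \<Phi> g \<omega>1 \<alpha>1 \<alpha>2
  assumes \<beta>: "\<beta> > -1" and KM: "K * (2 * \<beta> + 4) + 1 < M" and AB: "A > 0" "B > 0"
    and \<alpha>: "norm \<alpha>1 = 1" "norm \<alpha>2 = 1" and g: "g ` torus \<subseteq> torus" and \<omega>1: "\<omega>1 \<in> torus"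
    and \<Phi>: "\<And>z. z \<in> bidisc \<Longrightarrow> norm (fst (\<Phi> z)) \<le> 1 \<and> norm (snd (\<Phi> z)) \<le> 1"
    and near: "\<forall>\<^sub>F T in at_right 0. A * T powr M \<le> T \<and> T \<le> 1/2 \<and> B * T powr (M - K) < 1 \<and>
      (\<forall>\<theta> z1 z2. T \<le> \<theta> \<longrightarrow> \<theta> \<le> 2 * T \<longrightarrow>
        norm (z1 - of_real (1 - A * T powr M) * (\<omega>1 * cis \<theta>)) < A * T powr M / 8 \<longrightarrow>
        norm (z2 - of_real (1 - A * T powr M) * g (\<omega>1 * cis \<theta>)) < A * T powr M / 8 \<longrightarrow>
        norm (\<alpha>1 - fst (\<Phi> (z1, z2))) \<le> B * T powr (M - K) \<and>
        norm (\<alpha>2 - snd (\<Phi> (z1, z2))) \<le> B * T powr (M - K))"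
  shows "\<not> bounded_composition_operator \<beta> \<Phi>"
proof
  assume "bounded_composition_operator \<beta> \<Phi>"
  then obtain C0 where bdd: "\<And>f. f \<in> bergman_space \<beta> \<Longrightarrow> f \<circ> \<Phi> \<in> bergman_space \<beta>"
    "\<And>f. f \<in> bergman_space \<beta> \<Longrightarrow> bergman_norm \<beta> (f \<circ> \<Phi>) \<le> C0 * bergman_norm \<beta> f"
    unfolding bounded_composition_operator_def by blast
  define n where "n = nat \<lceil>\<beta>\<rceil> + 2"
  have n: "real n > \<beta> + 1" "n \<ge> 2" unfolding n_def by linarith+
  obtain C where C: "C > 0" and upper: "\<And>\<alpha>1 \<alpha>2 \<delta>. norm \<alpha>1 = 1 \<Longrightarrow> norm \<alpha>2 = 1 \<Longrightarrow> 0 < \<delta> \<Longrightarrow> \<delta> < 1 \<Longrightarrow>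
    kernel_power n (of_real (1 - \<delta>) * \<alpha>1, of_real (1 - \<delta>) * \<alpha>2) \<in> bergman_space \<beta> \<and>
    (bergman_norm \<beta> (kernel_power n (of_real (1 - \<delta>) * \<alpha>1, of_real (1 - \<delta>) * \<alpha>2)))\<^sup>2
      \<le> C * \<delta> powr (2 * \<beta> + 4 - 4 * real n)"
    using kernel_power_bergman[OF \<beta> n] by blast
  obtain c where c: "c > 0" and lower: "\<And>F g \<omega>1 r T L. F \<in> bergman_space \<beta> \<Longrightarrow> g ` torus \<subseteq> torus \<Longrightarrow> \<omega>1 \<in> torus \<Longrightarrow>
    0 < r \<Longrightarrow> r \<le> T \<Longrightarrow> T \<le> 1/2 \<Longrightarrow> 0 \<le> L \<Longrightarrow>
    (\<And>\<theta> z1 z2. T \<le> \<theta> \<Longrightarrow> \<theta> \<le> 2 * T \<Longrightarrow> norm (z1 - of_real (1 - r) * (\<omega>1 * cis \<theta>)) < r / 8 \<Longrightarrow>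
      norm (z2 - of_real (1 - r) * g (\<omega>1 * cis \<theta>)) < r / 8 \<Longrightarrow> L \<le> (norm (F (z1, z2)))\<^sup>2) \<Longrightarrow>
    c * L * T * r powr (2 * \<beta> + 3) \<le> (bergman_norm \<beta> F)\<^sup>2"
    using bergman_norm_lower_bound[of \<beta>] by blast
  \<comment> \<open>The excess of \<open>(M - K) * (2 * \<beta> + 4)\<close> over
    \<open>1 + M * (2 * \<beta> + 3)\<close>; its positivity is exactly \<open>KM\<close>.\<close>
  define e where "e = M - K * (2 * \<beta> + 4) - 1"
  define c3 where "c3 = c * (1 / 2) ^ (4 * n) * A powr (2 * \<beta> + 3)"
  define c4 where "c4 = C0\<^sup>2 * C * B powr (2 * \<beta> + 4)"
  have "e > 0" using KM by (simp add: e_def)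
  have "c3 > 0" using c AB by (simp add: c3_def)
  have "\<forall>\<^sub>F T in at_right 0. T > (0::real)" by (simp add: eventually_at_filter)
  with near have "\<forall>\<^sub>F T in at_right 0. c3 \<le> c4 * T powr e"
  proof eventually_elim
    case (elim T)
    define r \<delta> where "r = A * T powr M" and "\<delta> = B * T powr (M - K)"
    have r: "0 < r" "r \<le> T" "T \<le> 1/2" and \<delta>: "0 < \<delta>" "\<delta> < 1" using elim AB by (auto simp: r_def \<delta>_def)
    define f where "f = kernel_power n (of_real (1 - \<delta>) * \<alpha>1, of_real (1 - \<delta>) * \<alpha>2)"
    have f: "f \<in> bergman_space \<beta>" "(bergman_norm \<beta> f)\<^sup>2 \<le> C * \<delta> powr (2 * \<beta> + 4 - 4 * real n)"
      using upper[OF \<alpha> \<delta>] by (auto simp: f_def)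
    have "c * ((1 / 2) ^ (4 * n) * \<delta> powr (- 4 * real n)) * T * r powr (2 * \<beta> + 3) \<le> (bergman_norm \<beta> (f \<circ> \<Phi>))\<^sup>2"
    proof (rule lower[OF bdd(1)[OF f(1)] g \<omega>1 r])
      fix \<theta> z1 z2
      assume \<theta>: "T \<le> \<theta>" "\<theta> \<le> 2 * T"
        and z: "norm (z1 - of_real (1 - r) * (\<omega>1 * cis \<theta>)) < r / 8"
          "norm (z2 - of_real (1 - r) * g (\<omega>1 * cis \<theta>)) < r / 8"
      have nw: "norm (\<omega>1 * cis \<theta>) = 1" using \<omega>1 by (simp add: norm_mult)
      have ng: "norm (g (\<omega>1 * cis \<theta>)) = 1" using g nw by (auto simp: image_subset_iff)
      have r2: "r \<le> 1/2" using r by simp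
      have "(z1, z2) \<in> bidisc"
        using weight_near_circle(1)[OF r(1) r2 nw z(1)] weight_near_circle(1)[OF r(1) r2 ng z(2)]
        by (simp add: bidisc_def)
      note le1 = \<Phi>[OF this]
      have "norm (\<alpha>1 - fst (\<Phi> (z1, z2))) \<le> \<delta> \<and> norm (\<alpha>2 - snd (\<Phi> (z1, z2))) \<le> \<delta>"
        using elim(1) \<theta> z unfolding r_def \<delta>_def by blast
      with kernel_power_lower_bound[OF \<alpha> \<delta>, of "fst (\<Phi> (z1, z2))" "snd (\<Phi> (z1, z2))" n] le1
      show "(1 / 2) ^ (4 * n) * \<delta> powr (- 4 * real n) \<le> (norm ((f \<circ> \<Phi>) (z1, z2)))\<^sup>2"
        by (simp add: f_def)
    qed auto
    also have "\<dots> \<le> (C0 * bergman_norm \<beta> f)\<^sup>2"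
    proof (rule power_mono[OF bdd(2)[OF f(1)]])
      show "0 \<le> bergman_norm \<beta> (f \<circ> \<Phi>)"
        unfolding bergman_norm_def set_lebesgue_integral_def
        by (intro real_sqrt_ge_zero integral_nonneg_AE) (simp add: bergman_weight_def)
    qed
    also have "\<dots> \<le> C0\<^sup>2 * (C * \<delta> powr (2 * \<beta> + 4 - 4 * real n))"
      unfolding power_mult_distrib by (intro mult_left_mono f) auto
    also have "\<delta> powr (2 * \<beta> + 4 - 4 * real n) = \<delta> powr (2 * \<beta> + 4) * \<delta> powr (- 4 * real n)"
      by (simp flip: powr_add)
    finally have main: "c * (1 / 2) ^ (4 * n) * (T * r powr (2 * \<beta> + 3)) * \<delta> powr (- 4 * real n)
      \<le> C0\<^sup>2 * C * \<delta> powr (2 * \<beta> + 4) * \<delta> powr (- 4 * real n)"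
      by (simp only: mult_ac)
    \<comment> \<open>The powers carrying \<open>n\<close> cancel, so the size of \<open>n\<close>
      affects only constants.\<close>
    have le: "c * (1 / 2) ^ (4 * n) * (T * r powr (2 * \<beta> + 3)) \<le> C0\<^sup>2 * C * \<delta> powr (2 * \<beta> + 4)"
      by (rule mult_right_le_imp_le[OF main]) (use \<delta> in simp)
    have eq1: "T * r powr (2 * \<beta> + 3) = A powr (2 * \<beta> + 3) * T powr (1 + M * (2 * \<beta> + 3))"
      using AB elim(2) unfolding r_def powr_add[of T 1] by (simp add: powr_mult powr_powr)
    have eq2: "\<delta> powr (2 * \<beta> + 4) = B powr (2 * \<beta> + 4) * T powr (e + (1 + M * (2 * \<beta> + 3)))"
    proof -
      have "(M - K) * (2 * \<beta> + 4) = e + (1 + M * (2 * \<beta> + 3))" by (simp add: e_def algebra_simps)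
      then show ?thesis using AB elim(2) unfolding \<delta>_def by (simp add: powr_mult powr_powr)
    qed
    have "c3 * T powr (1 + M * (2 * \<beta> + 3)) \<le> (c4 * T powr e) * T powr (1 + M * (2 * \<beta> + 3))"
      using le unfolding c3_def c4_def eq1 eq2 powr_add[of T e] by (simp only: mult_ac)
    then show ?case by (rule mult_right_le_imp_le) (use elim(2) in simp)
  qed
  moreover have "((\<lambda>T. c4 * T powr e) \<longlongrightarrow> 0) (at_right 0)"
    by (rule tendsto_powr_0_at_right) fact
  ultimately have "c3 \<le> 0"
    by (intro tendsto_lowerbound[of "\<lambda>T. c4 * T powr e" 0 "at_right 0"]) auto
  with \<open>c3 > 0\<close> show False by simp
qed

lemma torus_cis_distance:
  assumes "\<omega>1 \<in> torus" "0 \<le> \<theta>" "\<theta> \<le> 1"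
  shows "\<theta> / 2 \<le> dist (\<omega>1 * cis \<theta>) \<omega>1" "dist (\<omega>1 * cis \<theta>) \<omega>1 \<le> \<theta>"
proof -
  have "\<omega>1 * cis \<theta> - \<omega>1 = \<omega>1 * (cis \<theta> - cis 0)" by (simp add: algebra_simps)
  then have "dist (\<omega>1 * cis \<theta>) \<omega>1 = norm (cis \<theta> - cis 0)"
    using assms by (simp only: dist_norm norm_mult mem_sphere_0 mult_1)
  then show "\<theta> / 2 \<le> dist (\<omega>1 * cis \<theta>) \<omega>1" "dist (\<omega>1 * cis \<theta>) \<omega>1 \<le> \<theta>"
    using norm_cis_diff_bounds[of \<theta> 0] assms by simp_all
qed

text \<open>The radius \<open>A T\<^sup>M\<close> dominates the gap between the two branches, so that the polydiscs around
  them overlap.\<close>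

lemma values_near_branches:
  fixes K K1 K2 M :: real and \<phi>1 \<phi>2 :: "complex \<times> complex \<Rightarrow> complex"
  assumes \<omega>1: "\<omega>1 \<in> torus" and K: "0 \<le> K" "K1 \<le> K" "K2 \<le> K" "0 < K1" "0 < K2" and M: "M > K" "M > 1"
    and E1: "C1 > 0" "\<forall>\<^sub>F \<zeta> in at \<omega>1 within torus. \<forall>r z1 z2. 0 < r \<longrightarrow> r < 1 \<longrightarrow>
    norm (z1 - of_real (1 - r) * \<zeta>) \<le> r / 2 \<longrightarrow> norm (z2 - of_real (1 - r) * g1 \<zeta>) \<le> r / 2 \<longrightarrow>
    norm (\<alpha>1 - \<phi>1 (z1, z2)) \<le> C1 * r * dist \<zeta> \<omega>1 powr (-K1)"
    and E2: "C2 > 0" "\<forall>\<^sub>F \<zeta> in at \<omega>1 within torus. \<forall>r z1 z2. 0 < r \<longrightarrow> r < 1 \<longrightarrow>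
    norm (z1 - of_real (1 - r) * \<zeta>) \<le> r / 2 \<longrightarrow> norm (z2 - of_real (1 - r) * g2 \<zeta>) \<le> r / 2 \<longrightarrow>
    norm (\<alpha>2 - \<phi>2 (z1, z2)) \<le> C2 * r * dist \<zeta> \<omega>1 powr (-K2)"
    and E3: "C3 > 0" "\<forall>\<^sub>F \<zeta> in at \<omega>1 within torus. norm (g1 \<zeta> - g2 \<zeta>) \<le> C3 * dist \<zeta> \<omega>1 powr M"
  shows "\<exists>A B. A > 0 \<and> B > 0 \<and> (\<forall>\<^sub>F T in at_right 0. A * T powr M \<le> T \<and> T \<le> 1/2 \<and> B * T powr (M - K) < 1 \<and>
      (\<forall>\<theta> z1 z2. T \<le> \<theta> \<longrightarrow> \<theta> \<le> 2 * T \<longrightarrow>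
        norm (z1 - of_real (1 - A * T powr M) * (\<omega>1 * cis \<theta>)) < A * T powr M / 8 \<longrightarrow>
        norm (z2 - of_real (1 - A * T powr M) * g1 (\<omega>1 * cis \<theta>)) < A * T powr M / 8 \<longrightarrow>
        norm (\<alpha>1 - \<phi>1 (z1, z2)) \<le> B * T powr (M - K) \<and>
        norm (\<alpha>2 - \<phi>2 (z1, z2)) \<le> B * T powr (M - K)))"
proof -
  \<comment> \<open>Chosen so that the gap between the branches, at most
    \<open>C3 * (2 * T) powr M\<close> as \<open>dist \<zeta> \<omega>1 \<le> 2 * T\<close>, is at
    most \<open>r / 8\<close>.\<close>
  define A where "A = 8 * C3 * 2 powr M"
  define B where "B = (C1 + C2) * A * 2 powr K"
  have A: "A > 0" using E3 by (simp add: A_def)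
  have B: "B > 0" using A E1 E2 by (simp add: B_def)
  define Q1 where "Q1 \<zeta> \<longleftrightarrow> (\<forall>r z1 z2. 0 < r \<longrightarrow> r < 1 \<longrightarrow>
    norm (z1 - of_real (1 - r) * \<zeta>) \<le> r / 2 \<longrightarrow> norm (z2 - of_real (1 - r) * g1 \<zeta>) \<le> r / 2 \<longrightarrow>
    norm (\<alpha>1 - \<phi>1 (z1, z2)) \<le> C1 * r * dist \<zeta> \<omega>1 powr (-K1))" for \<zeta>
  define Q2 where "Q2 \<zeta> \<longleftrightarrow> (\<forall>r z1 z2. 0 < r \<longrightarrow> r < 1 \<longrightarrow>
    norm (z1 - of_real (1 - r) * \<zeta>) \<le> r / 2 \<longrightarrow> norm (z2 - of_real (1 - r) * g2 \<zeta>) \<le> r / 2 \<longrightarrow>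
    norm (\<alpha>2 - \<phi>2 (z1, z2)) \<le> C2 * r * dist \<zeta> \<omega>1 powr (-K2))" for \<zeta>
  have "\<forall>\<^sub>F \<zeta> in at \<omega>1 within torus. Q1 \<zeta> \<and> Q2 \<zeta> \<and> norm (g1 \<zeta> - g2 \<zeta>) \<le> C3 * dist \<zeta> \<omega>1 powr M"
    using E1(2)[folded Q1_def] E2(2)[folded Q2_def] E3(2) by (intro eventually_conj)
  then obtain \<epsilon> where \<epsilon>: "\<epsilon> > 0" and P: "\<And>\<zeta>. \<zeta> \<in> torus \<Longrightarrow> \<zeta> \<noteq> \<omega>1 \<Longrightarrow> dist \<zeta> \<omega>1 < \<epsilon> \<Longrightarrow>
      Q1 \<zeta> \<and> Q2 \<zeta> \<and> norm (g1 \<zeta> - g2 \<zeta>) \<le> C3 * dist \<zeta> \<omega>1 powr M"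
    unfolding eventually_at by blast
  have ev1: "\<forall>\<^sub>F T in at_right 0. A * T powr (M - 1) < 1"
    using order_tendstoD(2)[OF tendsto_powr_0_at_right[of "M - 1" A], of 1] M by simp
  have ev2: "\<forall>\<^sub>F T in at_right 0. B * T powr (M - K) < 1"
    using order_tendstoD(2)[OF tendsto_powr_0_at_right[of "M - K" B], of 1] M by simp
  have ev3: "\<forall>\<^sub>F T in at_right 0. T \<in> {0<..<min (1/2) (\<epsilon> / 2)}"
    by (rule eventually_at_right_real) (use \<epsilon> in simp)
  show ?thesis
  proof (rule exI[of _ A], rule exI[of _ B], intro conjI A B)
    show "\<forall>\<^sub>F T in at_right 0. A * T powr M \<le> T \<and> T \<le> 1/2 \<and> B * T powr (M - K) < 1 \<and>
      (\<forall>\<theta> z1 z2. T \<le> \<theta> \<longrightarrow> \<theta> \<le> 2 * T \<longrightarrow>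
        norm (z1 - of_real (1 - A * T powr M) * (\<omega>1 * cis \<theta>)) < A * T powr M / 8 \<longrightarrow>
        norm (z2 - of_real (1 - A * T powr M) * g1 (\<omega>1 * cis \<theta>)) < A * T powr M / 8 \<longrightarrow>
        norm (\<alpha>1 - \<phi>1 (z1, z2)) \<le> B * T powr (M - K) \<and>
        norm (\<alpha>2 - \<phi>2 (z1, z2)) \<le> B * T powr (M - K))"
      using ev1 ev2 ev3
    proof eventually_elim
      case (elim T)
      define r where "r = A * T powr M"
      have T: "0 < T" "T < 1/2" "2 * T < \<epsilon>" using elim(3) by auto
      have "r = A * T powr (M - 1) * T" using T by (simp add: r_def powr_diff)
      also have "\<dots> \<le> 1 * T" using elim(1) T by (intro mult_right_mono) auto
      finally have rT: "r \<le> T" by simp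
      have r0: "0 < r" using A T by (simp add: r_def)
      have goal: "norm (\<alpha>1 - \<phi>1 (z1, z2)) \<le> B * T powr (M - K) \<and> norm (\<alpha>2 - \<phi>2 (z1, z2)) \<le> B * T powr (M - K)"
        if \<theta>: "T \<le> \<theta>" "\<theta> \<le> 2 * T" and z: "norm (z1 - of_real (1 - r) * (\<omega>1 * cis \<theta>)) < r / 8"
          "norm (z2 - of_real (1 - r) * g1 (\<omega>1 * cis \<theta>)) < r / 8" for \<theta> z1 z2
      proof -
        define \<zeta> t where "\<zeta> = \<omega>1 * cis \<theta>" and "t = dist \<zeta> \<omega>1"
        have "\<theta> / 2 \<le> t" "t \<le> \<theta>"
          unfolding \<zeta>_def t_def using torus_cis_distance[OF \<omega>1, of \<theta>] \<theta> T by simp_all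
        then have t: "T / 2 \<le> t" "t \<le> 2 * T" using \<theta> by simp_all
        have \<zeta>: "\<zeta> \<in> torus" "\<zeta> \<noteq> \<omega>1" "dist \<zeta> \<omega>1 < \<epsilon>"
          using \<omega>1 t T by (auto simp: \<zeta>_def norm_mult t_def)
        have PP: "Q1 \<zeta>" "Q2 \<zeta>" "norm (g1 \<zeta> - g2 \<zeta>) \<le> C3 * t powr M"
          unfolding t_def using P[OF \<zeta>] by auto
        have "t powr M \<le> (2 * T) powr M" using t T M by (intro powr_mono2) auto
        also have "\<dots> = 2 powr M * T powr M" using T by (simp add: powr_mult)
        finally have "C3 * t powr M \<le> C3 * (2 powr M * T powr M)" using E3(1) by simp
        also have "\<dots> = r / 8" by (simp add: r_def A_def)
        finally have g12: "norm (g1 \<zeta> - g2 \<zeta>) \<le> r / 8" using PP(3) by linarith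
        \<comment> \<open>Two monotonicities: \<open>t \<ge> T / 2\<close> with a negative exponent,
          then \<open>T / 2 < 1\<close>, which lets the larger order \<open>K\<close> replace
          \<open>Kj\<close>.\<close>
        have powr: "t powr (-Kj) \<le> 2 powr K * T powr (-K)" if "Kj \<le> K" "0 < Kj" for Kj
        proof -
          have "t powr (-Kj) \<le> (T / 2) powr (-Kj)" using t T that by (intro powr_mono2') auto
          also have "\<dots> \<le> (T / 2) powr (-K)" using T that by (intro powr_mono') auto
          also have "\<dots> = 2 powr K * T powr (-K)" using T by (simp add: powr_divide powr_minus field_simps)
          finally show ?thesis .
        qed
        have step: "Cj * r * t powr (-Kj) \<le> B * T powr (M - K)" if "0 < Cj" "Cj \<le> C1 + C2" "Kj \<le> K" "0 < Kj" for Cj Kj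
        proof -
          have "Cj * r * t powr (-Kj) \<le> (C1 + C2) * r * (2 powr K * T powr (-K))"
            using that powr[OF that(3,4)] r0 by (intro mult_mono) auto
          also have "\<dots> = B * (T powr M * T powr (-K))" by (simp only: r_def B_def mult_ac)
          also have "T powr M * T powr (-K) = T powr (M - K)" by (simp flip: powr_add)
          finally show ?thesis .
        qed
        have z1: "norm (z1 - of_real (1 - r) * \<zeta>) \<le> r / 2" "norm (z2 - of_real (1 - r) * g1 \<zeta>) \<le> r / 2"
          using z r0 unfolding \<zeta>_def by linarith+
        \<comment> \<open>A point within \<open>r / 8\<close> of the first centre is within
          \<open>r / 8 + r / 8\<close> of the second, inside the tolerance \<open>r / 2\<close> of
          \<open>Q2\<close>; thus one set of points serves both functions.\<close>
        have "norm (z2 - of_real (1 - r) * g2 \<zeta>) \<le> norm (z2 - of_real (1 - r) * g1 \<zeta>) + norm (of_real (1 - r) * (g1 \<zeta> - g2 \<zeta>))"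
        proof -
          have "z2 - of_real (1 - r) * g2 \<zeta> = (z2 - of_real (1 - r) * g1 \<zeta>) + of_real (1 - r) * (g1 \<zeta> - g2 \<zeta>)"
            by (simp add: algebra_simps)
          then show ?thesis by (simp only: norm_triangle_ineq)
        qed
        also have "norm (of_real (1 - r) * (g1 \<zeta> - g2 \<zeta>)) \<le> 1 * (r / 8)"
          unfolding norm_mult using g12 r0 rT T by (intro mult_mono) (auto simp del: of_real_diff)
        finally have z2: "norm (z2 - of_real (1 - r) * g2 \<zeta>) \<le> r / 2"
          using z(2) r0 unfolding \<zeta>_def by linarith
        have r1: "r < 1" using rT T by simp
        have "norm (\<alpha>1 - \<phi>1 (z1, z2)) \<le> C1 * r * t powr (-K1)" "norm (\<alpha>2 - \<phi>2 (z1, z2)) \<le> C2 * r * t powr (-K2)"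
          using PP(1)[unfolded Q1_def] PP(2)[unfolded Q2_def] z1 z2 r0 r1 unfolding t_def by blast+
        moreover have "C1 * r * t powr (-K1) \<le> B * T powr (M - K)" "C2 * r * t powr (-K2) \<le> B * T powr (M - K)"
          using E1 E2 K by (intro step; simp)+
        ultimately show ?thesis by linarith
      qed
      show ?case
        using rT T elim(2) goal unfolding r_def by (intro conjI allI impI) (blast | simp)+
    qed
  qed
qed

theorem theorem2p8:
  fixes p1 p2 :: "complex poly poly"
    and \<phi>1 \<phi>2 :: "complex \<times> complex \<Rightarrow> complex"
    and \<Phi> :: "complex \<times> complex \<Rightarrow> complex \<times> complex"
    and \<omega> :: "complex \<times> complex"
    and \<alpha>1 \<alpha>2 \<tau>1 \<tau>2 :: complex
    and N1 N2 j1 j2 :: nat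
    and g1 g2 :: "nat \<Rightarrow> complex \<Rightarrow> complex"
    and K1 K2 K M :: real
  assumes rif1: "rif_denominator p1" "\<phi>1 = rif p1"
    and rif2: "rif_denominator p2" "\<phi>2 = rif p2"
    and Phi: "\<Phi> = (\<lambda>z. (\<phi>1 z, \<phi>2 z))"
    and singularity: "\<omega> \<in> singularities p1" "\<omega> \<in> singularities p2"
    and generic: "generic_value \<phi>1 \<alpha>1" "generic_value \<phi>2 \<alpha>2"
    and admissible: "admissible_value \<phi>1 \<omega> \<alpha>1" "admissible_value \<phi>2 \<omega> \<alpha>2"
    and puncture: "\<tau>1 \<in> torus - {fst \<omega>}" "\<tau>2 \<in> torus - {fst \<omega>}"
    and param1: "level_parametrization \<phi>1 \<alpha>1 \<tau>1 N1 g1"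
    and param2: "level_parametrization \<phi>2 \<alpha>2 \<tau>2 N2 g2"
    and branches: "j1 < N1" "j2 < N2"
    and intersect: "g1 j1 (fst \<omega>) = snd \<omega>" "g2 j2 (fst \<omega>) = snd \<omega>"
    and contact1: "branch_contact_order \<phi>1 \<omega> (g1 j1) K1" "K1 \<ge> 2"
    and contact2: "branch_contact_order \<phi>2 \<omega> (g2 j2) K2" "K2 \<ge> 2"
    and K: "K = max K1 K2"
    and M: "M > 2 * K + 1"
    and tangential: "(\<lambda>\<zeta>. norm (g1 j1 \<zeta> - g2 j2 \<zeta>))
      \<in> \<Theta>[at (fst \<omega>) within torus](\<lambda>\<zeta>. dist \<zeta> (fst \<omega>) powr M)"
  shows "(\<forall>\<beta>>-1. M > K * (2 * \<beta> + 4) + 1 \<longrightarrow> \<not> bounded_composition_operator \<beta> \<Phi>) \<and>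
    (\<forall>\<beta>. -1 < \<beta> \<and> \<beta> < (M - 1) / (2 * K) - 2 \<longrightarrow> \<not> bounded_composition_operator \<beta> \<Phi>)"
proof -
  have st: "stable p1" "stable p2" using rif1 rif2 by (simp_all add: rif_denominator_def)
  have \<omega>1: "fst \<omega> \<in> torus" using singularity by (auto simp: singularities_def bitorus_def)
  have \<alpha>: "norm \<alpha>1 = 1" "norm \<alpha>2 = 1" using generic by (auto simp: generic_value_def)
  have K2: "2 \<le> K" "K1 \<le> K" "K2 \<le> K" using K contact1(2) by auto
  have \<Theta>: "(\<lambda>\<zeta>. inverse (norm (deriv (\<lambda>w. rif p1 (\<zeta>, w)) (g1 j1 \<zeta>))))
       \<in> \<Theta>[at (fst \<omega>) within torus](\<lambda>\<zeta>. dist \<zeta> (fst \<omega>) powr K1)"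
    "(\<lambda>\<zeta>. inverse (norm (deriv (\<lambda>w. rif p2 (\<zeta>, w)) (g2 j2 \<zeta>))))
       \<in> \<Theta>[at (fst \<omega>) within torus](\<lambda>\<zeta>. dist \<zeta> (fst \<omega>) powr K2)"
    using contact1(1) contact2(1) rif1(2) rif2(2) by (simp_all add: branch_contact_order_def)
  obtain C1 where C1: "C1 > 0" "\<forall>\<^sub>F \<zeta> in at (fst \<omega>) within torus. \<forall>r z1 z2. 0 < r \<longrightarrow> r < 1 \<longrightarrow>
    norm (z1 - of_real (1 - r) * \<zeta>) \<le> r / 2 \<longrightarrow> norm (z2 - of_real (1 - r) * g1 j1 \<zeta>) \<le> r / 2 \<longrightarrow>
    norm (\<alpha>1 - rif p1 (z1, z2)) \<le> C1 * r * dist \<zeta> (fst \<omega>) powr (-K1)"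
    using rif_near_branch[OF st(1) \<omega>1 _ param1[unfolded rif1(2)] branches(1) _ \<Theta>(1)] puncture(1) contact1(2)
    by auto
  obtain C2 where C2: "C2 > 0" "\<forall>\<^sub>F \<zeta> in at (fst \<omega>) within torus. \<forall>r z1 z2. 0 < r \<longrightarrow> r < 1 \<longrightarrow>
    norm (z1 - of_real (1 - r) * \<zeta>) \<le> r / 2 \<longrightarrow> norm (z2 - of_real (1 - r) * g2 j2 \<zeta>) \<le> r / 2 \<longrightarrow>
    norm (\<alpha>2 - rif p2 (z1, z2)) \<le> C2 * r * dist \<zeta> (fst \<omega>) powr (-K2)"
    using rif_near_branch[OF st(2) \<omega>1 _ param2[unfolded rif2(2)] branches(2) _ \<Theta>(2)] puncture(2) contact2(2)
    by auto
  obtain C3 where C3: "C3 > 0" "\<forall>\<^sub>F \<zeta> in at (fst \<omega>) within torus.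
    norm (norm (g1 j1 \<zeta> - g2 j2 \<zeta>)) \<le> C3 * norm (dist \<zeta> (fst \<omega>) powr M)"
    using landau_o.bigE[OF bigthetaD1[OF tangential]] .
  have M2: "M > K" "M > 1" and pos: "0 \<le> K" "0 < K1" "0 < K2" using M K2 contact1(2) contact2(2) by linarith+
  obtain A B where AB: "A > 0" "B > 0" and near: "\<forall>\<^sub>F T in at_right 0. A * T powr M \<le> T \<and> T \<le> 1/2 \<and> B * T powr (M - K) < 1 \<and>
      (\<forall>\<theta> z1 z2. T \<le> \<theta> \<longrightarrow> \<theta> \<le> 2 * T \<longrightarrow>
        norm (z1 - of_real (1 - A * T powr M) * (fst \<omega> * cis \<theta>)) < A * T powr M / 8 \<longrightarrow>
        norm (z2 - of_real (1 - A * T powr M) * g1 j1 (fst \<omega> * cis \<theta>)) < A * T powr M / 8 \<longrightarrow>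
        norm (\<alpha>1 - rif p1 (z1, z2)) \<le> B * T powr (M - K) \<and>
        norm (\<alpha>2 - rif p2 (z1, z2)) \<le> B * T powr (M - K))"
    using values_near_branches[OF \<omega>1 pos(1) K2(2,3) pos(2,3) M2 C1 C2 C3(1)] C3(2) by auto
  have g: "g1 j1 ` torus \<subseteq> torus"
    using level_parametrization_branch[OF param1 branches(1)] by blast
  have main: "\<not> bounded_composition_operator \<beta> \<Phi>" if \<beta>: "\<beta> > -1" "K * (2 * \<beta> + 4) + 1 < M" for \<beta>
  proof (rule not_bounded_if_concentrated[OF \<beta> AB \<alpha> g \<omega>1])
    show "norm (fst (\<Phi> z)) \<le> 1 \<and> norm (snd (\<Phi> z)) \<le> 1" if "z \<in> bidisc" for z
      using norm_rif_le_1[OF st(1), of "fst z" "snd z"] norm_rif_le_1[OF st(2), of "fst z" "snd z"] that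
      by (auto simp: Phi rif1(2) rif2(2) bidisc_def)
  qed (use near in \<open>simp add: Phi rif1(2) rif2(2)\<close>)
  moreover have "K * (2 * \<beta> + 4) + 1 < M" if "\<beta> < (M - 1) / (2 * K) - 2" for \<beta>
  proof -
    have "\<beta> + 2 < (M - 1) / (2 * K)" using that by simp
    then have "(\<beta> + 2) * (2 * K) < M - 1" using K2 by (simp only: pos_less_divide_eq)
    then show ?thesis by (simp add: algebra_simps)
  qed
  ultimately show ?thesis by blast
qed

end
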